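(* Let $W$ be the weakening monad on $[\mathcal H^{\mathrm{op}},\mathbf{Set}]$, i.e. the monad induced by the free-forgetful adjunction $\{w\}\text{-}\mathbf{GAT}\leftrightarrows[\mathcal H^{\mathrm{op}},\mathbf{Set}]$, with $WX$ described by heaps as in the context. For each $X\in[\mathcal H^{\mathrm{op}},\mathbf{Set}]$, the unit map $\eta^W_X\colon X\to WX$ has components $$X(n)\to WX(n),\ A\mapsto(\gamma_n,\tilde A)\qquad\text{and}\qquad \mathrm{Tm}_X(A)\to\mathrm{Tm}_{WX}(\gamma_n,\tilde A),\ a\mapsto a.$$
   Context: \textbf{Expressions and judgements.} Fix a denumerable set $\mathrm{Var}$ of variables. Given an alphabet $\Xi$, the expressions over $\Xi$ are generated as follows: each $x\in\mathrm{Var}$ is an expression; if $n\geq 0$, $e_1,\dots,e_n$ are expressions and $w\in\Xi$, then $w(e_1,\dots,e_n)$ is an expression (written $w$ when $n=0$). $\mathsf{fv}$ denotes free variables and $e'[e/x]$ substitution of $e$ for $x$ in $e'$. A context is a (possibly empty) list $x_1:T_1,\dots,x_n:T_n$ of distinct variables $x_i$ and expressions $T_i$; $\mathsf{fv}(\Gamma)$ is the set of variables occurring in $\Gamma$. A judgement is a string $\Gamma\vdash T\ \mathsf{type}$ (type judgement), $\Gamma\vdash t:T$ (term judgement), $\Gamma\vdash T=T'\ \mathsf{type}$ (type equality) or $\Gamma\vdash t=t':T$ (term equality), with $\Gamma$ a context and $t,t',T,T'$ expressions; its degree is one more than the length of $\Gamma$. The boundary of a judgement is a list of judgements: $\partial(\vdash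 T\ \mathsf{type})=()$; $\partial(\Gamma,x:T\vdash T'\ \mathsf{type})=(\Gamma\vdash T\ \mathsf{type})$; $\partial(\Gamma\vdash t:T)=(\Gamma\vdash T\ \mathsf{type})$; $\partial(\Gamma\vdash T=T'\ \mathsf{type})=(\Gamma\vdash T\ \mathsf{type},\ \Gamma\vdash T'\ \mathsf{type})$; $\partial(\Gamma\vdash t=t':T)=(\Gamma\vdash t:T,\ \Gamma\vdash t':T)$. \textbf{Deduction rules} (premises $\Longrightarrow$ conclusion; $\mathcal J$ stands for the right-hand side of any of the four judgement forms). \emph{Equality and $\alpha$ rules}: $\Gamma\vdash t:T\Longrightarrow\Gamma\vdash t=t:T$; $\Gamma\vdash t_1=t_2:T\Longrightarrow\Gamma\vdash t_2=t_1:T$; $\Gamma\vdash t_1=t_2:T$ and $\Gamma\vdash t_2=t_3:T\Longrightarrow\Gamma\vdash t_1=t_3:T$; $\Gamma\vdash T\ \mathsf{type}\Longrightarrow\Gamma\vdash T=T\ \mathsf{type}$; $\Gamma\vdash T_1=T_2\ \mathsf{type}\Longrightarrow\Gamma\vdash T_2=T_1\ \mathsf{type}$; $\Gamma\vdash T_1=T_2\ \mathsf{type}$ and $\Gamma\vdash T_2=T_3\ \mathsf{type}\Longrightarrow\Gamma\vdash T_1=T_3\ \mathsf{type}$; $\Gamma\vdash T_1=T_2\ \mathsf{type}$ and $\Gamma\vdash t:T_1\Longrightarrow\Gamma\vdash t:T_2$; $\Gamma\vdash T_1=T_2\ \mathsf{type}$ and $\Gamma\vdash t_1=t_2:T_1\Longrightarrow\Gamma\vdash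 t_1=t_2:T_2$; $\Gamma\vdash\mathcal J\Longrightarrow\sigma\cdot\Gamma\vdash\sigma\cdot\mathcal J$ for any permutation $\sigma\in\mathrm{Sym}(\mathrm{Var})$ acting on variables. \emph{Weakening} ($w$): $\Gamma\vdash T\ \mathsf{type}$ and $\Gamma,\Delta\vdash\mathcal J\Longrightarrow\Gamma,y:T,\Delta\vdash\mathcal J$, for $y\notin\mathsf{fv}(\Gamma)\cup\mathsf{fv}(\Delta)$. \textbf{$\{w\}$-GATs.} A $\{w\}$-GAT $\mathbb T$ consists of a collection $\Omega$ of type-constants, a collection $\Sigma$ of term-constants and a collection $\Lambda$ of basic judgements over $\Omega\amalg\Sigma$ such that: for each $A\in\Omega$ there is a unique judgement in $\Lambda$ of the form $x_1:T_1,\dots,x_{n-1}:T_{n-1}\vdash A(x_1,\dots,x_{n-1})\ \mathsf{type}$; for each $f\in\Sigma$ there is a unique judgement in $\Lambda$ of the form $x_1:T_1,\dots,x_{n-1}:T_{n-1}\vdash f(x_1,\dots,x_{n-1}):T$; all other elements of $\Lambda$ are type or term equality judgements; each element of $\Lambda$ lies in $\mathbb T^*$. Here $\mathbb T^*$, the collection of derived judgements, is the smallest collection closed under all the rules listed above and containing $\mathcal J\in\Lambda$ whenever it contains each judgement in $\partial(\mathcal J)$. An interpretation $\phi\colon\mathbb T\to\mathbb U$ is a function $\phi\colon\mathbb T^*\to\mathbb U^*$ preserving boundaries and preserving deduction: viewing each rule with $n$ premises (for each choice of parameters such as $y$ or $\sigma$) as an $n$-ary partial function $r$ on judgements, $\phi(r(\mathcal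 J_1,\dots,\mathcal J_n))=r(\phi(\mathcal J_1),\dots,\phi(\mathcal J_n))$ whenever both sides are defined. On derived type judgements, $(x_1:S_1,\dots,x_{n-1}:S_{n-1}\vdash S_n\ \mathsf{type})\equiv(y_1:T_1,\dots,y_{m-1}:T_{m-1}\vdash T_m\ \mathsf{type})$ iff $n=m$ and for $1\le i\le n$ the judgement $x_1:S_1,\dots,x_{i-1}:S_{i-1}\vdash S_i=T_i[x_1/y_1,\dots,x_{i-1}/y_{i-1}]\ \mathsf{type}$ is derived. On derived term judgements, $(x_1:S_1,\dots,x_{n-1}:S_{n-1}\vdash s:S_n)\equiv(y_1:T_1,\dots,y_{m-1}:T_{m-1}\vdash t:T_m)$ iff their boundaries are $\equiv$ and $x_1:S_1,\dots,x_{n-1}:S_{n-1}\vdash s=t[x_1/y_1,\dots,x_{n-1}/y_{n-1}]:S_n$ is derived. $\{w\}\text{-}\mathbf{GAT}$ has $\{w\}$-GATs as objects and, as morphisms, interpretations modulo: $\phi\sim\phi'$ iff $\phi(\mathcal J)\equiv\phi'(\mathcal J)$ for each derived type or term judgement $\mathcal J$. \textbf{Type-and-term structures and the monad.} $[a,b]=\{a,\dots,b\}\subset\mathbb N$ and $[n]=[1,n]$. $\mathcal H$ is the category freely generated by the graph with objects $n$ and $n_t$ ($n\ge1$) and arrows $n\to n+1$ and $n\to n_t$. For $X\in[\mathcal H^{\mathrm{op}},\mathbf{Set}]$ the maps $X(n+1)\to X(n)$, $X(n_t)\to X(n)$ are written $\partial$; elements of $X(n)$ are type-elements, elements of $X(n_t)$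 term-elements; for $A\in X(n)$, $\mathrm{Tm}_X(A)=\{a\in X(n_t):\partial a=A\}$. The forgetful functor $V\colon\{w\}\text{-}\mathbf{GAT}\to[\mathcal H^{\mathrm{op}},\mathbf{Set}]$ has $V\mathbb T(n)$ (resp. $V\mathbb T(n_t)$) the set of derived type (resp. term) judgements of degree $n$ modulo $\equiv$, boundaries induced by $\partial$, and $V\phi([\mathcal J])=[\phi(\mathcal J)]$. Its left adjoint $G$ sends $X$ to the free $\{w\}$-GAT $GX$ whose type- and term-constants are the type- and term-elements of $X$ and whose basic judgements are $\mathcal J_A=(x_1:A_1,x_2:A_2(x_1),\dots,x_{n-1}:A_{n-1}(x_1,\dots,x_{n-2})\vdash A(x_1,\dots,x_{n-1})\ \mathsf{type})$ for $A\in X(n)$, where $A_i=\partial^{n-i}A$, and, in the same context, $\mathcal J_a=(\dots\vdash a(x_1,\dots,x_{n-1}):A(x_1,\dots,x_{n-1}))$ for $a\in\mathrm{Tm}_X(A)$. The adjunction unit is $\eta_X(A)=[\mathcal J_A]$, $\eta_X(a)=[\mathcal J_a]$. The monad is $W=VG$. \textbf{Heaps and description of $WX$.} A min-heap of size $n$ is a function $\phi\colon[0,n]\to[0,n]$ with $\phi(0)=0$ and $\phi(i)<i$ for $i\in[n]$; $\mathrm{Hp}(n)$ is the set of these. For $\phi\in\mathrm{Hp}(n+1)$, $\partial\phi\in\mathrm{Hp}(n)$ is its restriction to $[0,n]$. For $i\in[n]$, $\mathsf{dp}_\phi(i)=|\{\phi(i),\phi^2(i),\dots\}|$. The presheaf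 $[\phi]$ has $[\phi](m)=\{i\in[n]:\mathsf{dp}_\phi(i)=m\}$, $[\phi](m_t)=\emptyset$, and $\partial(i)=\phi(i)$. For $h\colon[\phi]\to X$, $\partial h$ is its restriction to $[\partial\phi]$. One has $WX(n)=\sum_{\phi\in\mathrm{Hp}(n)}[\mathcal H^{\mathrm{op}},\mathbf{Set}]([\phi],X)$ with $\partial(\phi,h)=(\partial\phi,\partial h)$ and $\mathrm{Tm}_{WX}(\phi,h)=\mathrm{Tm}_X(h(n))$, where $(\phi,h)$ is identified with the class of the judgement $x_1:T_1,\dots,x_{n-1}:T_{n-1}\vdash T_n\ \mathsf{type}$ of $GX$ in which $T_i=h(i)(x_{j_1},\dots,x_{j_{k-1}})$, $k=\mathsf{dp}_\phi(i)$, $j_\ell=\phi^{k-\ell}(i)$; and $a\in\mathrm{Tm}_X(h(n))$ with the class of $x_1:T_1,\dots,x_{n-1}:T_{n-1}\vdash a(x_{j_1},\dots,x_{j_{k-1}}):T_n$, with the indices $j_\ell$ for $i=n$. \textbf{Notation.} $\gamma_n\in\mathrm{Hp}(n)$ is given by $\gamma_n(0)=0$ and $\gamma_n(i)=i-1$ otherwise; for $A\in X(n)$, $\tilde A\colon[\gamma_n]\to X$ is given by $\tilde A(i)=\partial^{n-i}(A)$. *)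

theory Defs
  imports "HOL-Library.FuncSet" "HOL-Library.Countable"
begin

section \<open>Expressions and judgements\<close>

datatype (fv: 'v, syms: 's) expr = Var 'v | App 's "('v, 's) expr list"

datatype (rhs_fv: 'v, rhs_syms: 's) rhs =
    IsTy "('v, 's) expr"
  | HasTy "('v, 's) expr" "('v, 's) expr"    \<comment> \<open>\<open>HasTy t T\<close> is \<open>t : T\<close>\<close>
  | EqTy "('v, 's) expr" "('v, 's) expr"
  | EqTm "('v, 's) expr" "('v, 's) expr" "('v, 's) expr"
      \<comment> \<open>\<open>EqTm t t' T\<close> is \<open>t = t' : T\<close>\<close>

type_synonym ('v, 's) ctx = "('v \<times> ('v, 's) expr) list"
type_synonym ('v, 's) judgement = "('v, 's) ctx \<times> ('v, 's) rhs"

definition ctx_fv :: "('v, 's) ctx \<Rightarrow> 'v set" where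
  "ctx_fv \<Gamma> = (\<Union>(y, T) \<in> set \<Gamma>. insert y (fv T))"

definition judgements_over :: "'s set \<Rightarrow> ('v, 's) judgement set" where
  "judgements_over \<Xi> =
    {(\<Gamma>, J). distinct (map fst \<Gamma>) \<and> (\<forall>(y, T) \<in> set \<Gamma>. syms T \<subseteq> \<Xi>) \<and> rhs_syms J \<subseteq> \<Xi>}"

definition degree :: "('v, 's) judgement \<Rightarrow> nat" where
  "degree J = Suc (length (fst J))"

fun boundary :: "('v, 's) judgement \<Rightarrow> ('v, 's) judgement list" where
  "boundary (\<Gamma>, IsTy T) = (if \<Gamma> = [] then [] else [(butlast \<Gamma>, IsTy (snd (last \<Gamma>)))])"
| "boundary (\<Gamma>, HasTy t T) = [(\<Gamma>, IsTy T)]"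
| "boundary (\<Gamma>, EqTy T T') = [(\<Gamma>, IsTy T), (\<Gamma>, IsTy T')]"
| "boundary (\<Gamma>, EqTm t t' T) = [(\<Gamma>, HasTy t T), (\<Gamma>, HasTy t' T)]"

definition permute :: "('v \<Rightarrow> 'v) \<Rightarrow> ('v, 's) judgement \<Rightarrow> ('v, 's) judgement" where
  "permute \<sigma> J =
    (map (\<lambda>(y, T). (\<sigma> y, map_expr \<sigma> id T)) (fst J), map_rhs \<sigma> id (snd J))"

primrec subst :: "('v \<Rightarrow> ('v, 's) expr) \<Rightarrow> ('v, 's) expr \<Rightarrow> ('v, 's) expr" where
  "subst \<rho> (Var y) = \<rho> y"
| "subst \<rho> (App w es) = App w (map (subst \<rho>) es)"

text \<open>\<open>subst_vars xs ys e\<close> is the simultaneous substitution \<open>e[xs/ys]\<close>.\<close>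

definition subst_vars :: "'v list \<Rightarrow> 'v list \<Rightarrow> ('v, 's) expr \<Rightarrow> ('v, 's) expr" where
  "subst_vars xs ys =
    subst (\<lambda>y. case map_of (zip ys xs) y of None \<Rightarrow> Var y | Some z \<Rightarrow> Var z)"


section \<open>Derivations and \<open>{w}\<close>-GATs\<close>

inductive_set deriv :: "('v, 's) judgement set \<Rightarrow> ('v, 's) judgement set"
  for \<Lambda> :: "('v, 's) judgement set"
where
  basic: "\<lbrakk>J \<in> \<Lambda>; \<forall>B \<in> set (boundary J). B \<in> deriv \<Lambda>\<rbrakk> \<Longrightarrow> J \<in> deriv \<Lambda>"
| tm_refl: "(\<Gamma>, HasTy t T) \<in> deriv \<Lambda> \<Longrightarrow> (\<Gamma>, EqTm t t T) \<in> deriv \<Lambda>"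
| tm_sym: "(\<Gamma>, EqTm t\<^sub>1 t\<^sub>2 T) \<in> deriv \<Lambda> \<Longrightarrow> (\<Gamma>, EqTm t\<^sub>2 t\<^sub>1 T) \<in> deriv \<Lambda>"
| tm_trans: "\<lbrakk>(\<Gamma>, EqTm t\<^sub>1 t\<^sub>2 T) \<in> deriv \<Lambda>; (\<Gamma>, EqTm t\<^sub>2 t\<^sub>3 T) \<in> deriv \<Lambda>\<rbrakk>
    \<Longrightarrow> (\<Gamma>, EqTm t\<^sub>1 t\<^sub>3 T) \<in> deriv \<Lambda>"
| ty_refl: "(\<Gamma>, IsTy T) \<in> deriv \<Lambda> \<Longrightarrow> (\<Gamma>, EqTy T T) \<in> deriv \<Lambda>"
| ty_sym: "(\<Gamma>, EqTy T\<^sub>1 T\<^sub>2) \<in> deriv \<Lambda> \<Longrightarrow> (\<Gamma>, EqTy T\<^sub>2 T\<^sub>1) \<in> deriv \<Lambda>"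
| ty_trans: "\<lbrakk>(\<Gamma>, EqTy T\<^sub>1 T\<^sub>2) \<in> deriv \<Lambda>; (\<Gamma>, EqTy T\<^sub>2 T\<^sub>3) \<in> deriv \<Lambda>\<rbrakk>
    \<Longrightarrow> (\<Gamma>, EqTy T\<^sub>1 T\<^sub>3) \<in> deriv \<Lambda>"
| tm_conv: "\<lbrakk>(\<Gamma>, EqTy T\<^sub>1 T\<^sub>2) \<in> deriv \<Lambda>; (\<Gamma>, HasTy t T\<^sub>1) \<in> deriv \<Lambda>\<rbrakk>
    \<Longrightarrow> (\<Gamma>, HasTy t T\<^sub>2) \<in> deriv \<Lambda>"
| eq_conv: "\<lbrakk>(\<Gamma>, EqTy T\<^sub>1 T\<^sub>2) \<in> deriv \<Lambda>; (\<Gamma>, EqTm t\<^sub>1 t\<^sub>2 T\<^sub>1) \<in> deriv \<Lambda>\<rbrakk>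
    \<Longrightarrow> (\<Gamma>, EqTm t\<^sub>1 t\<^sub>2 T\<^sub>2) \<in> deriv \<Lambda>"
| alpha: "\<lbrakk>J \<in> deriv \<Lambda>; bij \<sigma>\<rbrakk> \<Longrightarrow> permute \<sigma> J \<in> deriv \<Lambda>"
| weakening: "\<lbrakk>(\<Gamma>, IsTy T) \<in> deriv \<Lambda>; (\<Gamma> @ \<Delta>, J) \<in> deriv \<Lambda>; y \<notin> ctx_fv \<Gamma> \<union> ctx_fv \<Delta>\<rbrakk>
    \<Longrightarrow> (\<Gamma> @ (y, T) # \<Delta>, J) \<in> deriv \<Lambda>"

record ('v, 'o, 's) gat =
  type_consts :: "'o set"
  term_consts :: "'s set"
  basics :: "('v, 'o + 's) judgement set"

definition derived :: "('v, 'o, 's) gat \<Rightarrow> ('v, 'o + 's) judgement set" where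
  "derived T = deriv (basics T)"

definition introduces_type :: "'o \<Rightarrow> ('v, 'o + 's) judgement \<Rightarrow> bool" where
  "introduces_type A J \<longleftrightarrow> (\<exists>\<Gamma>. J = (\<Gamma>, IsTy (App (Inl A) (map (Var \<circ> fst) \<Gamma>))))"

definition introduces_term :: "'s \<Rightarrow> ('v, 'o + 's) judgement \<Rightarrow> bool" where
  "introduces_term f J \<longleftrightarrow> (\<exists>\<Gamma> T. J = (\<Gamma>, HasTy (App (Inr f) (map (Var \<circ> fst) \<Gamma>)) T))"

definition is_equality :: "('v, 's) judgement \<Rightarrow> bool" where
  "is_equality J \<longleftrightarrow> (\<exists>\<Gamma> T T'. J = (\<Gamma>, EqTy T T')) \<or> (\<exists>\<Gamma> t t' T. J = (\<Gamma>, EqTm t t' T))"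

definition w_gat :: "('v, 'o, 's) gat \<Rightarrow> bool" where
  "w_gat T \<longleftrightarrow>
     basics T \<subseteq> judgements_over (type_consts T <+> term_consts T) \<and>
     (\<forall>A \<in> type_consts T. \<exists>!J. J \<in> basics T \<and> introduces_type A J) \<and>
     (\<forall>f \<in> term_consts T. \<exists>!J. J \<in> basics T \<and> introduces_term f J) \<and>
     (\<forall>J \<in> basics T. (\<exists>A \<in> type_consts T. introduces_type A J) \<or>
        (\<exists>f \<in> term_consts T. introduces_term f J) \<or> is_equality J) \<and>
     basics T \<subseteq> derived T"


section \<open>Type-and-term structures\<close>

text \<open>
  A presheaf on the free category \<open>\<H>\<close> is given by its values on objects and on the generating
  arrows: \<open>ty X n\<close> is $X(n)$, \<open>tm X n\<close> is $X(n_t)$, \<open>bdty X n\<close> is $X(n+1) \to X(n)$ and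
  \<open>bdtm X n\<close> is $X(n_t) \to X(n)$. There is no object \<open>0\<close>, so the entries at \<open>0\<close> are
  required to be empty.
\<close>

record ('a, 'b) psh =
  ty :: "nat \<Rightarrow> 'a set"
  tm :: "nat \<Rightarrow> 'b set"
  bdty :: "nat \<Rightarrow> 'a \<Rightarrow> 'a"
  bdtm :: "nat \<Rightarrow> 'b \<Rightarrow> 'a"

definition presheaf :: "('a, 'b) psh \<Rightarrow> bool" where
  "presheaf X \<longleftrightarrow> ty X 0 = {} \<and> tm X 0 = {} \<and>
     (\<forall>n\<ge>1. bdty X n \<in> ty X (Suc n) \<rightarrow> ty X n) \<and>
     (\<forall>n\<ge>1. bdtm X n \<in> tm X n \<rightarrow> ty X n)"

definition Tm :: "('a, 'b) psh \<Rightarrow> nat \<Rightarrow> 'a \<Rightarrow> 'b set" where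
  "Tm X n A = {a \<in> tm X n. bdtm X n a = A}"

text \<open>\<open>bd_iter X n k\<close> is $\partial^k \colon X(n) \to X(n-k)$.\<close>

primrec bd_iter :: "('a, 'b) psh \<Rightarrow> nat \<Rightarrow> nat \<Rightarrow> 'a \<Rightarrow> 'a" where
  "bd_iter X n 0 A = A"
| "bd_iter X n (Suc k) A = bdty X (n - Suc k) (bd_iter X n k A)"

record ('a, 'b, 'c, 'd) psh_map =
  on_ty :: "nat \<Rightarrow> 'a \<Rightarrow> 'c"
  on_tm :: "nat \<Rightarrow> 'b \<Rightarrow> 'd"

text \<open>Components are taken to be extensional, so that equality of maps is equality of records.\<close>

definition psh_hom :: "('a, 'b) psh \<Rightarrow> ('c, 'd) psh \<Rightarrow> ('a, 'b, 'c, 'd) psh_map set" where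
  "psh_hom P Q = {f.
     (\<forall>n. on_ty f n \<in> ty P n \<rightarrow>\<^sub>E ty Q n) \<and>
     (\<forall>n. on_tm f n \<in> tm P n \<rightarrow>\<^sub>E tm Q n) \<and>
     (\<forall>n\<ge>1. \<forall>A \<in> ty P (Suc n). on_ty f n (bdty P n A) = bdty Q n (on_ty f (Suc n) A)) \<and>
     (\<forall>n\<ge>1. \<forall>a \<in> tm P n. on_ty f n (bdtm P n a) = bdtm Q n (on_tm f n a))}"

definition psh_restrict :: "('a, 'b) psh \<Rightarrow> ('a, 'b, 'c, 'd) psh_map \<Rightarrow> ('a, 'b, 'c, 'd) psh_map"
  where
  "psh_restrict P f = \<lparr>on_ty = (\<lambda>n. restrict (on_ty f n) (ty P n)),
                       on_tm = (\<lambda>n. restrict (on_tm f n) (tm P n))\<rparr>"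

definition psh_comp :: "('a, 'b) psh \<Rightarrow> ('c, 'd, 'e, 'f) psh_map \<Rightarrow> ('a, 'b, 'c, 'd) psh_map
    \<Rightarrow> ('a, 'b, 'e, 'f) psh_map" where
  "psh_comp P g f = \<lparr>on_ty = (\<lambda>n. compose (ty P n) (on_ty g n) (on_ty f n)),
                     on_tm = (\<lambda>n. compose (tm P n) (on_tm g n) (on_tm f n))\<rparr>"


section \<open>The forgetful functor \<open>V\<close> on objects\<close>

text \<open>
  The telescope $(S_1, \dots, S_n)$ of a type judgement
  $x_1:S_1, \dots, x_{n-1}:S_{n-1} \vdash S_n\ \mathsf{type}$.
\<close>

definition telescope :: "('v, 's) ctx \<Rightarrow> ('v, 's) expr \<Rightarrow> ('v, 's) expr list" where
  "telescope \<Gamma> S = map snd \<Gamma> @ [S]"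

definition ty_equiv :: "('v, 'o, 's) gat \<Rightarrow> ('v, 'o + 's) judgement \<Rightarrow> ('v, 'o + 's) judgement \<Rightarrow> bool"
  where
  "ty_equiv T J J' \<longleftrightarrow> (\<exists>\<Gamma> S \<Delta> S'. J = (\<Gamma>, IsTy S) \<and> J' = (\<Delta>, IsTy S') \<and>
     length \<Gamma> = length \<Delta> \<and>
     (\<forall>i \<le> length \<Gamma>.
        (take i \<Gamma>, EqTy (telescope \<Gamma> S ! i)
           (subst_vars (take i (map fst \<Gamma>)) (take i (map fst \<Delta>)) (telescope \<Delta> S' ! i)))
        \<in> derived T))"

definition tm_equiv :: "('v, 'o, 's) gat \<Rightarrow> ('v, 'o + 's) judgement \<Rightarrow> ('v, 'o + 's) judgement \<Rightarrow> bool"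
  where
  "tm_equiv T J J' \<longleftrightarrow> (\<exists>\<Gamma> s S \<Delta> t S'. J = (\<Gamma>, HasTy s S) \<and> J' = (\<Delta>, HasTy t S') \<and>
     ty_equiv T (\<Gamma>, IsTy S) (\<Delta>, IsTy S') \<and>
     (\<Gamma>, EqTm s (subst_vars (map fst \<Gamma>) (map fst \<Delta>) t) S) \<in> derived T)"

definition derived_ty :: "('v, 'o, 's) gat \<Rightarrow> nat \<Rightarrow> ('v, 'o + 's) judgement set" where
  "derived_ty T n = {J \<in> derived T. degree J = n \<and> (\<exists>\<Gamma> S. J = (\<Gamma>, IsTy S))}"

definition derived_tm :: "('v, 'o, 's) gat \<Rightarrow> nat \<Rightarrow> ('v, 'o + 's) judgement set" where
  "derived_tm T n = {J \<in> derived T. degree J = n \<and> (\<exists>\<Gamma> s S. J = (\<Gamma>, HasTy s S))}"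

definition ty_rel :: "('v, 'o, 's) gat \<Rightarrow> nat \<Rightarrow> (('v, 'o + 's) judgement \<times> ('v, 'o + 's) judgement) set"
  where "ty_rel T n = {(J, J'). J \<in> derived_ty T n \<and> J' \<in> derived_ty T n \<and> ty_equiv T J J'}"

definition tm_rel :: "('v, 'o, 's) gat \<Rightarrow> nat \<Rightarrow> (('v, 'o + 's) judgement \<times> ('v, 'o + 's) judgement) set"
  where "tm_rel T n = {(J, J'). J \<in> derived_tm T n \<and> J' \<in> derived_tm T n \<and> tm_equiv T J J'}"

abbreviation ty_class :: "('v, 'o, 's) gat \<Rightarrow> nat \<Rightarrow> ('v, 'o + 's) judgement \<Rightarrow> ('v, 'o + 's) judgement set"
  where "ty_class T n J \<equiv> ty_rel T n `` {J}"

abbreviation tm_class :: "('v, 'o, 's) gat \<Rightarrow> nat \<Rightarrow> ('v, 'o + 's) judgement \<Rightarrow> ('v, 'o + 's) judgement set"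
  where "tm_class T n J \<equiv> tm_rel T n `` {J}"

definition V :: "('v, 'o, 's) gat \<Rightarrow> (('v, 'o + 's) judgement set, ('v, 'o + 's) judgement set) psh"
  where
  "V T = \<lparr>ty = (\<lambda>n. derived_ty T n // ty_rel T n),
          tm = (\<lambda>n. derived_tm T n // tm_rel T n),
          bdty = (\<lambda>n c. the_elem ((\<lambda>J. ty_class T n (hd (boundary J))) ` c)),
          bdtm = (\<lambda>n c. the_elem ((\<lambda>J. ty_class T n (hd (boundary J))) ` c))\<rparr>"


section \<open>The free \<open>{w}\<close>-GAT \<open>GX\<close> and the adjunction unit\<close>

text \<open>
  Elements of $X$ are tagged with their degree, since the sets $X(n)$ need not be disjoint.
  The sequence \<open>x\<close> supplies the distinct variables $x_1, x_2, \dots$ (\<open>x 0\<close> is never used).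
\<close>

definition generic_type ::
    "(nat \<Rightarrow> 'v) \<Rightarrow> nat \<Rightarrow> 'a \<Rightarrow> ('v, (nat \<times> 'a) + (nat \<times> 'b)) expr" where
  "generic_type x n A = App (Inl (n, A)) (map (Var \<circ> x) [1..<n])"

definition generic_ctx ::
    "(nat \<Rightarrow> 'v) \<Rightarrow> ('a, 'b) psh \<Rightarrow> nat \<Rightarrow> 'a \<Rightarrow> ('v, (nat \<times> 'a) + (nat \<times> 'b)) ctx" where
  "generic_ctx x X n A = map (\<lambda>i. (x i, generic_type x i (bd_iter X n (n - i) A))) [1..<n]"

definition J_type ::
    "(nat \<Rightarrow> 'v) \<Rightarrow> ('a, 'b) psh \<Rightarrow> nat \<Rightarrow> 'a \<Rightarrow> ('v, (nat \<times> 'a) + (nat \<times> 'b)) judgement" where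
  "J_type x X n A = (generic_ctx x X n A, IsTy (generic_type x n A))"

definition J_term ::
    "(nat \<Rightarrow> 'v) \<Rightarrow> ('a, 'b) psh \<Rightarrow> nat \<Rightarrow> 'b \<Rightarrow> ('v, (nat \<times> 'a) + (nat \<times> 'b)) judgement" where
  "J_term x X n a =
    (generic_ctx x X n (bdtm X n a),
     HasTy (App (Inr (n, a)) (map (Var \<circ> x) [1..<n])) (generic_type x n (bdtm X n a)))"

definition G :: "(nat \<Rightarrow> 'v) \<Rightarrow> ('a, 'b) psh \<Rightarrow> ('v, nat \<times> 'a, nat \<times> 'b) gat" where
  "G x X = \<lparr>type_consts = Sigma {1..} (ty X),
            term_consts = Sigma {1..} (tm X),
            basics = {J_type x X n A | n A. 1 \<le> n \<and> A \<in> ty X n} \<union>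
                     {J_term x X n a | n a. 1 \<le> n \<and> a \<in> tm X n}\<rparr>"

lemma psh_bd: "presheaf X \<Longrightarrow> 1 \<le> n \<Longrightarrow> A \<in> ty X (Suc n) \<Longrightarrow> bdty X n A \<in> ty X n"
  unfolding presheaf_def by blast

lemma psh_bdtm: "presheaf X \<Longrightarrow> 1 \<le> n \<Longrightarrow> a \<in> tm X n \<Longrightarrow> bdtm X n a \<in> ty X n"
  unfolding presheaf_def by blast

lemma bd_iter_mem:
  assumes "presheaf X" "A \<in> ty X n" "k < n"
  shows "bd_iter X n k A \<in> ty X (n - k)"
  using assms(3)
proof (induction k)
  case (Suc k)
  then have "bd_iter X n k A \<in> ty X (Suc (n - Suc k))" by (simp add: Suc_diff_Suc)
  moreover have "n - Suc k \<ge> 1" using Suc by simp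
  ultimately show ?case using assms(1) unfolding presheaf_def bd_iter.simps by blast
qed (use assms in simp)

lemma bd_iter_bd: "bd_iter X n k (bdty X n A) = bd_iter X (Suc n) (Suc k) A"
  by (induction k) auto

lemma generic_boundary:
  assumes "n \<ge> 1"
  shows "boundary (J_type x X (Suc n) A) = [J_type x X n (bdty X n A)]"
proof -
  have "[1..<Suc n] = [1..<n] @ [n]" using assms by simp
  then have "generic_ctx x X (Suc n) A = generic_ctx x X n (bdty X n A) @ [(x n, generic_type x n (bdty X n A))]"
    unfolding generic_ctx_def by (auto simp: bd_iter_bd Suc_diff_le simp del: upt_Suc bd_iter.simps) (simp)
  then show ?thesis by (simp add: J_type_def)
qed

lemma J_type_derived:
  assumes "presheaf X" "A \<in> ty X n" 
  shows "J_type x X n A \<in> derived (G x X)"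
  using assms(2)
proof (induction n arbitrary: A)
  case 0 then show ?case using assms by (simp add: presheaf_def)
next
  case (Suc n)
  have b: "J_type x X (Suc n) A \<in> basics (G x X)" using Suc by (auto simp: G_def)
  show ?case
  proof (cases "n = 0")
    case True
    then have "boundary (J_type x X (Suc n) A) = []" by (simp add: J_type_def generic_ctx_def)
    then show ?thesis unfolding derived_def by (intro deriv.basic[OF b]) simp
  next
    case False
    then have "bdty X n A \<in> ty X n" using psh_bd[OF assms(1) _ Suc.prems] by simp
    with Suc have "J_type x X n (bdty X n A) \<in> derived (G x X)" by blast
    with False show ?thesis unfolding derived_def 
      by (intro deriv.basic[OF b]) (simp add: generic_boundary)
  qed
qed

lemma J_term_derived:
  assumes "presheaf X" "a \<in> tm X n" 
  shows "J_term x X n a \<in> derived (G x X)"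
proof -
  have n: "n \<ge> 1" using assms by (cases n) (auto simp: presheaf_def)
  then have "bdtm X n a \<in> ty X n" using psh_bdtm[OF assms(1)] assms(2) \<open>n \<ge> 1\<close> by simp
  from J_type_derived[OF assms(1) this, of x] show ?thesis
    unfolding derived_def using n assms(2)
    by (intro deriv.basic) (auto simp: G_def J_term_def J_type_def) 
qed

lemma generic_vars: "map (Var \<circ> fst) (generic_ctx x X n A) = map (Var \<circ> x) [1..<n]"
  by (simp add: generic_ctx_def)

theorem w_gat_G:
  assumes "presheaf X" "inj x"
  shows "w_gat (G x X)"
proof -
  let ?O = "type_consts (G x X)" and ?S = "term_consts (G x X)"
  have ty1: "J_type x X n A \<in> basics (G x X)" "introduces_type (n, A) (J_type x X n A)"
    "(n,A) \<in> ?O" if "n \<ge> 1" "A \<in> ty X n" for n A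
    using that by (auto simp: G_def introduces_type_def J_type_def generic_vars generic_type_def)
  have tm1: "J_term x X n A \<in> basics (G x X)" "introduces_term (n, A) (J_term x X n A)"
    "(n,A) \<in> ?S" if "n \<ge> 1" "A \<in> tm X n" for n A
    using that by (auto simp: G_def introduces_term_def J_term_def generic_vars generic_type_def)
  have bdt: "bdtm X n a \<in> ty X n" if "n \<ge> 1" "a \<in> tm X n" for n a
    using psh_bdtm[OF assms(1)] assms that by simp
  have al: "J_type x X n A \<in> judgements_over (?O <+> ?S)" if "n \<ge> 1" "A \<in> ty X n" for n A
  proof -
    have m: "bd_iter X n (n - i) A \<in> ty X i" if "1 \<le> i" "i < n" for i
      using bd_iter_mem[OF assms(1) \<open>A \<in> ty X n\<close>, of "n - i"] that by simp
    show ?thesis using that m assms(2)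
      by (auto simp: judgements_over_def J_type_def generic_ctx_def generic_type_def G_def
          distinct_map comp_def inj_on_def)
  qed
  have al2: "J_term x X n a \<in> judgements_over (?O <+> ?S)" if "n \<ge> 1" "a \<in> tm X n" for n a
    using al[OF that(1) bdt[OF that]] that tm1(3)[OF that]
    by (auto simp: judgements_over_def J_type_def J_term_def)
  have B: "J \<in> basics (G x X) \<longleftrightarrow> (\<exists>n A. 1 \<le> n \<and> A \<in> ty X n \<and> J = J_type x X n A) \<or>
    (\<exists>n a. 1 \<le> n \<and> a \<in> tm X n \<and> J = J_term x X n a)" for J by (auto simp: G_def)
  have u1: "\<exists>!J. J \<in> basics (G x X) \<and> introduces_type c J" if c: "c \<in> ?O" for c
  proof -
    obtain n A where nA: "c = (n, A)" "1 \<le> n" "A \<in> ty X n" using c by (auto simp: G_def)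
    show ?thesis
    proof (rule ex1I[of _ "J_type x X n A"])
      show "J = J_type x X n A" if "J \<in> basics (G x X) \<and> introduces_type c J" for J
        using that unfolding B nA(1) by (auto simp: introduces_type_def J_type_def J_term_def generic_type_def)
    qed (use nA ty1 in auto)
  qed
  have u2: "\<exists>!J. J \<in> basics (G x X) \<and> introduces_term c J" if c: "c \<in> ?S" for c
  proof -
    obtain n A where nA: "c = (n, A)" "1 \<le> n" "A \<in> tm X n" using c by (auto simp: G_def)
    show ?thesis
    proof (rule ex1I[of _ "J_term x X n A"])
      show "J = J_term x X n A" if "J \<in> basics (G x X) \<and> introduces_term c J" for J
        using that unfolding B nA(1) by (auto simp: introduces_term_def J_type_def J_term_def generic_type_def)
    qed (use nA tm1 in auto)
  qed
  have s1: "basics (G x X) \<subseteq> judgements_over (?O <+> ?S)" using al al2 B by (metis subsetI)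
  have s2: "basics (G x X) \<subseteq> derived (G x X)"
    using J_type_derived[OF assms(1), of _ _ x] J_term_derived[OF assms(1), of _ _ x] B by (metis subsetI)
  have s3: "(\<exists>A \<in> ?O. introduces_type A J) \<or> (\<exists>f \<in> ?S. introduces_term f J)" if "J \<in> basics (G x X)" for J
    using that ty1 tm1 unfolding B by metis
  show ?thesis
    unfolding w_gat_def using s1 s2 s3 u1 u2 by blast
qed

definition adj_unit :: "(nat \<Rightarrow> 'v) \<Rightarrow> ('a, 'b) psh \<Rightarrow>
    ('a, 'b, ('v, (nat \<times> 'a) + (nat \<times> 'b)) judgement set,
             ('v, (nat \<times> 'a) + (nat \<times> 'b)) judgement set) psh_map" where
  "adj_unit x X =
    \<lparr>on_ty = (\<lambda>n. \<lambda>A \<in> ty X n. ty_class (G x X) n (J_type x X n A)),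
     on_tm = (\<lambda>n. \<lambda>a \<in> tm X n. tm_class (G x X) n (J_term x X n a))\<rparr>"


section \<open>Heaps\<close>

definition Hp :: "nat \<Rightarrow> (nat \<Rightarrow> nat) set" where
  "Hp n = {\<phi> \<in> {0..n} \<rightarrow>\<^sub>E {0..n}. \<phi> 0 = 0 \<and> (\<forall>i \<in> {1..n}. \<phi> i < i)}"

definition dp :: "(nat \<Rightarrow> nat) \<Rightarrow> nat \<Rightarrow> nat" where
  "dp \<phi> i = card {(\<phi> ^^ k) i | k. 1 \<le> k}"

definition heap_psh :: "nat \<Rightarrow> (nat \<Rightarrow> nat) \<Rightarrow> (nat, unit) psh" where
  "heap_psh n \<phi> = \<lparr>ty = (\<lambda>m. {i \<in> {1..n}. dp \<phi> i = m}), tm = (\<lambda>m. {}),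
                   bdty = (\<lambda>m. \<phi>), bdtm = (\<lambda>m. undefined)\<rparr>"

definition bd_heap :: "nat \<Rightarrow> (nat \<Rightarrow> nat) \<Rightarrow> nat \<Rightarrow> nat" where
  "bd_heap n \<phi> = restrict \<phi> {0..n}"

definition heap_value :: "(nat \<Rightarrow> nat) \<Rightarrow> (nat, unit, 'a, 'b) psh_map \<Rightarrow> nat \<Rightarrow> 'a" where
  "heap_value \<phi> h i = on_ty h (dp \<phi> i) i"

type_synonym ('a, 'b) heap_el = "(nat \<Rightarrow> nat) \<times> (nat, unit, 'a, 'b) psh_map"

text \<open>
  The heap description of $WX$. A term-element over $(\phi, h)$ is a pair of $(\phi, h)$ with an
  element of $\mathrm{Tm}_X(h(n))$.
\<close>

definition W :: "('a, 'b) psh \<Rightarrow> (('a, 'b) heap_el, ('a, 'b) heap_el \<times> 'b) psh" where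
  "W X = \<lparr>ty = (\<lambda>n. {(\<phi>, h). 1 \<le> n \<and> \<phi> \<in> Hp n \<and> h \<in> psh_hom (heap_psh n \<phi>) X}),
          tm = (\<lambda>n. {((\<phi>, h), a). 1 \<le> n \<and> \<phi> \<in> Hp n \<and> h \<in> psh_hom (heap_psh n \<phi>) X \<and>
                       a \<in> Tm X (dp \<phi> n) (heap_value \<phi> h n)}),
          bdty = (\<lambda>n (\<phi>, h). (bd_heap n \<phi>, psh_restrict (heap_psh n (bd_heap n \<phi>)) h)),
          bdtm = (\<lambda>n. fst)\<rparr>"

text \<open>For $k = \mathsf{dp}_\phi(i)$, the list $x_{j_1}, \dots, x_{j_{k-1}}$ with $j_l = \phi^{k-l}(i)$.\<close>

definition heap_args :: "(nat \<Rightarrow> 'v) \<Rightarrow> (nat \<Rightarrow> nat) \<Rightarrow> nat \<Rightarrow> ('v, 's) expr list" where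
  "heap_args x \<phi> i = map (\<lambda>l. Var (x ((\<phi> ^^ (dp \<phi> i - l)) i))) [1..<dp \<phi> i]"

definition heap_type :: "(nat \<Rightarrow> 'v) \<Rightarrow> (nat \<Rightarrow> nat) \<Rightarrow> (nat, unit, 'a, 'b) psh_map \<Rightarrow> nat
    \<Rightarrow> ('v, (nat \<times> 'a) + (nat \<times> 'b)) expr" where
  "heap_type x \<phi> h i = App (Inl (dp \<phi> i, heap_value \<phi> h i)) (heap_args x \<phi> i)"

definition heap_ctx :: "(nat \<Rightarrow> 'v) \<Rightarrow> nat \<Rightarrow> (nat \<Rightarrow> nat) \<Rightarrow> (nat, unit, 'a, 'b) psh_map
    \<Rightarrow> ('v, (nat \<times> 'a) + (nat \<times> 'b)) ctx" where
  "heap_ctx x n \<phi> h = map (\<lambda>i. (x i, heap_type x \<phi> h i)) [1..<n]"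

definition heap_ty_judgement :: "(nat \<Rightarrow> 'v) \<Rightarrow> nat \<Rightarrow> ('a, 'b) heap_el
    \<Rightarrow> ('v, (nat \<times> 'a) + (nat \<times> 'b)) judgement" where
  "heap_ty_judgement x n = (\<lambda>(\<phi>, h). (heap_ctx x n \<phi> h, IsTy (heap_type x \<phi> h n)))"

definition heap_tm_judgement :: "(nat \<Rightarrow> 'v) \<Rightarrow> nat \<Rightarrow> ('a, 'b) heap_el \<times> 'b
    \<Rightarrow> ('v, (nat \<times> 'a) + (nat \<times> 'b)) judgement" where
  "heap_tm_judgement x n = (\<lambda>((\<phi>, h), a).
     (heap_ctx x n \<phi> h,
      HasTy (App (Inr (dp \<phi> n, a)) (heap_args x \<phi> n)) (heap_type x \<phi> h n)))"

definition heap_ident :: "(nat \<Rightarrow> 'v) \<Rightarrow> ('a, 'b) psh \<Rightarrow>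
    (('a, 'b) heap_el, ('a, 'b) heap_el \<times> 'b,
     ('v, (nat \<times> 'a) + (nat \<times> 'b)) judgement set,
     ('v, (nat \<times> 'a) + (nat \<times> 'b)) judgement set) psh_map" where
  "heap_ident x X =
    \<lparr>on_ty = (\<lambda>n. \<lambda>w \<in> ty (W X) n. ty_class (G x X) n (heap_ty_judgement x n w)),
     on_tm = (\<lambda>n. \<lambda>w \<in> tm (W X) n. tm_class (G x X) n (heap_tm_judgement x n w))\<rparr>"

text \<open>The adjunction unit lands in \<open>V (G x X)\<close>; it is transported to \<open>W X\<close> along \<open>heap_ident\<close>.\<close>

definition unit_W :: "(nat \<Rightarrow> 'v) \<Rightarrow> ('a, 'b) psh \<Rightarrow>
    ('a, 'b, ('a, 'b) heap_el, ('a, 'b) heap_el \<times> 'b) psh_map" where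
  "unit_W x X =
    \<lparr>on_ty = (\<lambda>n. \<lambda>A \<in> ty X n.
       the_inv_into (ty (W X) n) (on_ty (heap_ident x X) n) (on_ty (adj_unit x X) n A)),
     on_tm = (\<lambda>n. \<lambda>a \<in> tm X n.
       the_inv_into (tm (W X) n) (on_tm (heap_ident x X) n) (on_tm (adj_unit x X) n a))\<rparr>"

definition linear_heap :: "nat \<Rightarrow> nat \<Rightarrow> nat" where
  "linear_heap n = (\<lambda>i \<in> {0..n}. i - 1)"

definition tilde :: "('a, 'b) psh \<Rightarrow> nat \<Rightarrow> 'a \<Rightarrow> (nat, unit, 'a, 'b) psh_map" where
  "tilde X n A = psh_restrict (heap_psh n (linear_heap n))
     \<lparr>on_ty = (\<lambda>m i. bd_iter X n (n - i) A), on_tm = (\<lambda>m. undefined)\<rparr>"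

end

theory Submission
  imports Defs
begin

text \<open>
  The generic judgement of a type-element $A \in X(n)$ has context
  $x_1 : A_1, \dots, x_{n-1} : A_{n-1}(x_1, \dots, x_{n-2})$, in which every type depends on all
  the variables before it. This is literally the judgement described by the heap in which $i - 1$
  is the parent of $i$, labelled by the iterated boundaries of $A$; the same holds for
  term-elements (\<open>heap_ty_judgement_linear\<close>, \<open>heap_tm_judgement_linear\<close>). So the adjunction unit
  sends $A$ to the class that \<open>heap_ident\<close> assigns to $(\gamma_n, \tilde A)$.

  The unit of $W$ is obtained by inverting \<open>heap_ident\<close>, and what makes the inverse take
  the expected value is that \<open>heap_ident\<close> is injective. This has two parts.

  First, two equivalent heap judgements come from the same heap element. The free theory has no
  equality axioms, so a derivable equality has identical sides (\<open>deriv_eq_syntactic\<close>), and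
  equivalent judgements over the same variables coincide. The $i$-th type of a heap judgement
  shows the label of $i$ as its head symbol and the ancestors of $i$ other than $0$ as its
  arguments; the last argument is the parent of $i$, and the parent is $0$ if there is none. Hence both the heap and its labelling can be read off.

  Second, two heap judgements with the same class are equivalent. Classes consist of derivable
  judgements, and an underivable judgement has the empty class, so it has to be shown that every
  heap judgement is derivable. Let $i$ be a node of depth $k$ with
  label $A$. Renaming the variables of the generic judgement of $A$ to those of the branch
  leading to $i$ gives the heap judgement at $i$ restricted to that branch. The nodes off the
  branch are inserted by weakening, from left to right: their types are derivable by induction on
  the node, and their variables do not occur in the types along the branch because the branch is
  closed under ancestors (\<open>weaken_from_branch\<close>).
\<close>

section \<open>Judgemental equality in the free theory\<close>

text \<open>
  No rule other than the axioms produces an equality with different sides: reflexivity creates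
  equal sides, and symmetry, transitivity, conversion, renaming and weakening preserve this.
\<close>

lemma deriv_eq_syntactic:
  assumes "J \<in> deriv \<Lambda>" and "\<And>J. J \<in> \<Lambda> \<Longrightarrow> \<not> is_equality J"
  shows "case snd J of EqTy T T' \<Rightarrow> T = T' | EqTm t t' T \<Rightarrow> t = t' | _ \<Rightarrow> True"
  using assms(1)
proof (induction rule: deriv.induct)
  case (basic J)
  obtain \<Gamma> R where J: "J = (\<Gamma>, R)" by (cases J)
  show ?case using assms(2)[OF basic.hyps(1)] unfolding J by (cases R) (auto simp: is_equality_def)
next
  case (alpha J \<sigma>)
  then show ?case by (cases "snd J") (simp_all add: permute_def)
qed simp_all

lemma G_no_equalities: "J \<in> basics (G x X) \<Longrightarrow> \<not> is_equality J"
  by (auto simp: G_def is_equality_def J_type_def J_term_def)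

lemma derived_G_EqTy: "(\<Gamma>, EqTy T T') \<in> derived (G x X) \<Longrightarrow> T = T'"
  using deriv_eq_syntactic[OF _ G_no_equalities, of "(\<Gamma>, EqTy T T')" "basics (G x X)"]
  by (simp add: derived_def)

lemma derived_G_EqTm: "(\<Gamma>, EqTm t t' T) \<in> derived (G x X) \<Longrightarrow> t = t'"
  using deriv_eq_syntactic[OF _ G_no_equalities, of "(\<Gamma>, EqTm t t' T)" "basics (G x X)"]
  by (simp add: derived_def)

lemma subst_Var_id: "subst Var e = e"
  by (induction e) (auto intro: map_idI)

lemma subst_vars_same:
  fixes e :: "('v, 's) expr"
  shows "subst_vars xs xs e = e"
proof -
  have "(\<lambda>y. case map_of (zip xs xs) y of None \<Rightarrow> Var y | Some z \<Rightarrow> Var z) =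
      (Var :: 'v \<Rightarrow> ('v, 's) expr)"
  proof
    fix y
    have "z = y" if "map_of (zip xs xs) y = Some z" for z
      using map_of_SomeD[OF that] by (auto simp: in_set_zip)
    then show "(case map_of (zip xs xs) y of None \<Rightarrow> Var y | Some z \<Rightarrow> Var z) = (Var y :: ('v, 's) expr)"
      by (auto split: option.split)
  qed
  then show ?thesis by (simp add: subst_vars_def subst_Var_id)
qed

text \<open>
  The substitution in the definition of the equivalence is the identity when both contexts
  declare the same variables, so equivalence reduces to equality of telescopes.
\<close>

lemma ty_equiv_G_same_vars:
  assumes "ty_equiv (G x X) (\<Gamma>, IsTy S) (\<Delta>, IsTy S')" and "map fst \<Gamma> = map fst \<Delta>"
  shows "\<Gamma> = \<Delta>" and "S = S'"
proof -
  have len: "length \<Gamma> = length \<Delta>"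
    and eq: "\<And>i. i \<le> length \<Gamma> \<Longrightarrow> telescope \<Gamma> S ! i = telescope \<Delta> S' ! i"
    using assms by (auto simp: ty_equiv_def subst_vars_same dest!: derived_G_EqTy)
  have "telescope \<Gamma> S = telescope \<Delta> S'"
    by (rule nth_equalityI) (auto simp: len eq telescope_def[of \<Gamma>] telescope_def[of \<Delta>]
      eq[unfolded telescope_def] less_Suc_eq_le)
  then have "map snd \<Gamma> = map snd \<Delta>" "S = S'" by (auto simp: telescope_def)
  with assms(2) show "\<Gamma> = \<Delta>" "S = S'"
    by (auto intro: pair_list_eqI)
qed

section \<open>Renaming and iterated weakening\<close>

text \<open>
  The renaming rule of the calculus only offers permutations of all variables. A finite partial
  injection from $A$ onto $B$ extends to one by matching up $B \setminus A$ with
  $A \setminus B$, which have the same size, and fixing everything else.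
\<close>

lemma extend_to_bij:
  fixes x y :: "'i \<Rightarrow> 'v"
  assumes "finite I" "inj_on x I" "inj_on y I"
  shows "\<exists>\<sigma>. bij \<sigma> \<and> (\<forall>i\<in>I. \<sigma> (x i) = y i)"
proof -
  define A B where "A = x ` I" and "B = y ` I"
  define f where "f = y \<circ> the_inv_into I x"
  have fin: "finite A" "finite B" using assms(1) by (auto simp: A_def B_def)
  have f: "bij_betw f A B"
    unfolding f_def A_def B_def
    by (rule bij_betw_trans[OF bij_betw_the_inv_into[OF inj_on_imp_bij_betw[OF assms(2)]]
          inj_on_imp_bij_betw[OF assms(3)]])
  then have "card A = card B" by (rule bij_betw_same_card)
  then have "card (B - A) = card (A - B)"
    using fin by (metis card_le_sym_Diff order_antisym order_refl)
  then obtain g where g: "bij_betw g (B - A) (A - B)"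
    using fin finite_same_card_bij by (metis finite_Diff)
  define \<sigma> where "\<sigma> v = (if v \<in> A then f v else if v \<in> B - A then g v else v)" for v
  have "bij_betw \<sigma> A B" using f by (rule bij_betw_cong[THEN iffD1, rotated]) (simp add: \<sigma>_def)
  moreover have "bij_betw \<sigma> (B - A) (A - B)"
    using g by (rule bij_betw_cong[THEN iffD1, rotated]) (simp add: \<sigma>_def)
  ultimately have "bij_betw \<sigma> (A \<union> (B - A)) (B \<union> (A - B))" by (rule bij_betw_combine) auto
  moreover have "bij_betw \<sigma> (- (A \<union> B)) (- (A \<union> B))"
    using bij_betw_id by (rule bij_betw_cong[THEN iffD1, rotated]) (auto simp: \<sigma>_def)
  ultimately have "bij_betw \<sigma> ((A \<union> (B - A)) \<union> - (A \<union> B)) ((B \<union> (A - B)) \<union> - (A \<union> B))"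
    by (rule bij_betw_combine) auto
  moreover have "(A \<union> (B - A)) \<union> - (A \<union> B) = UNIV" "(B \<union> (A - B)) \<union> - (A \<union> B) = UNIV" by auto
  ultimately have "bij \<sigma>" by simp
  moreover have "\<sigma> (x i) = y i" if "i \<in> I" for i
    using that assms(2) by (simp add: \<sigma>_def A_def f_def the_inv_into_f_f)
  ultimately show ?thesis by blast
qed

text \<open>
  Iterated weakening: a judgement over part of a context holds over the whole context. The
  declarations missing from the part are inserted from left to right, so that the type of each is
  needed only over the full context to its left (\<open>\<Gamma>\<close> is what has been completed), while
  to its right only the declarations already present have to avoid the new variable.
\<close>

lemma derived_weaken_filter:
  assumes "(\<Gamma> @ filter P \<Delta>, J) \<in> derived T"
    and "\<And>\<Delta>\<^sub>1 y S \<Delta>\<^sub>2. \<Delta> = \<Delta>\<^sub>1 @ (y, S) # \<Delta>\<^sub>2 \<Longrightarrow> \<not> P (y, S) \<Longrightarrow>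
      (\<Gamma> @ \<Delta>\<^sub>1, IsTy S) \<in> derived T \<and> y \<notin> ctx_fv (\<Gamma> @ \<Delta>\<^sub>1) \<union> ctx_fv (filter P \<Delta>\<^sub>2)"
  shows "(\<Gamma> @ \<Delta>, J) \<in> derived T"
  using assms
proof (induction \<Delta> arbitrary: \<Gamma>)
  case Nil
  then show ?case by simp
next
  case (Cons d \<Delta>)
  obtain y S where d: "d = (y, S)" by (cases d)
  have "((\<Gamma> @ [d]) @ filter P \<Delta>, J) \<in> derived T"
  proof (cases "P d")
    case True
    then show ?thesis using Cons.prems(1) by simp
  next
    case False
    then show ?thesis
      using Cons.prems(1) Cons.prems(2)[of "[]" y S \<Delta>] d
      unfolding derived_def by (auto intro: deriv.weakening)
  qed
  then have "((\<Gamma> @ [d]) @ \<Delta>, J) \<in> derived T"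
  proof (rule Cons.IH)
    show "((\<Gamma> @ [d]) @ \<Delta>\<^sub>1, IsTy S) \<in> derived T \<and>
        y \<notin> ctx_fv ((\<Gamma> @ [d]) @ \<Delta>\<^sub>1) \<union> ctx_fv (filter P \<Delta>\<^sub>2)"
      if "\<Delta> = \<Delta>\<^sub>1 @ (y, S) # \<Delta>\<^sub>2" "\<not> P (y, S)" for \<Delta>\<^sub>1 y S \<Delta>\<^sub>2
      using Cons.prems(2)[of "d # \<Delta>\<^sub>1" y S \<Delta>\<^sub>2] that by simp
  qed
  then show ?case by simp
qed

lemma permute_generic:
  assumes "\<And>i. i \<in> {1..<n} \<Longrightarrow> \<sigma> (x i) = y i"
  shows "permute \<sigma> (J_type x X n A) = J_type y X n A"
    and "permute \<sigma> (J_term x X n a) = J_term y X n a"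
  using assms by (auto simp: permute_def J_type_def J_term_def generic_ctx_def generic_type_def)

lemma generic_derived_renamed:
  assumes "presheaf X" "inj x" "inj_on y {1..<n}"
  shows "A \<in> ty X n \<Longrightarrow> J_type y X n A \<in> derived (G x X)"
    and "a \<in> tm X n \<Longrightarrow> J_term y X n a \<in> derived (G x X)"
proof -
  have "inj_on x {1..<n}" using assms(2) by (rule inj_on_subset) simp
  then obtain \<sigma> where "bij \<sigma>" and \<sigma>: "\<And>i. i \<in> {1..<n} \<Longrightarrow> \<sigma> (x i) = y i"
    using extend_to_bij[of "{1..<n}" x y] assms(3) by auto
  then have perm: "permute \<sigma> J \<in> derived (G x X)" if "J \<in> derived (G x X)" for J
    using that deriv.alpha unfolding derived_def by blast
  show "J_type y X n A \<in> derived (G x X)" if "A \<in> ty X n"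
  proof -
    have "permute \<sigma> (J_type x X n A) = J_type y X n A" by (rule permute_generic(1)) (rule \<sigma>)
    then show ?thesis using perm[OF J_type_derived[OF assms(1) that]] by simp
  qed
  show "J_term y X n a \<in> derived (G x X)" if "a \<in> tm X n"
  proof -
    have "permute \<sigma> (J_term x X n a) = J_term y X n a" by (rule permute_generic(2)) (rule \<sigma>)
    then show ?thesis using perm[OF J_term_derived[OF assms(1) that]] by simp
  qed
qed

section \<open>Heaps and their branches\<close>

text \<open>The ancestor of \<open>i\<close> at depth \<open>l\<close>, written $j_l$ in the heap description of $WX$.\<close>

definition ancestor :: "(nat \<Rightarrow> nat) \<Rightarrow> nat \<Rightarrow> nat \<Rightarrow> nat" where
  "ancestor \<phi> i l = (\<phi> ^^ (dp \<phi> i - l)) i"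

locale heap =
  fixes n :: nat and \<phi> :: "nat \<Rightarrow> nat"
  assumes heap: "\<phi> \<in> Hp n"
begin

lemma parent_0: "\<phi> 0 = 0" and parent_less: "i \<in> {1..n} \<Longrightarrow> \<phi> i < i"
  using heap by (auto simp: Hp_def)

lemma parent_le: "i \<le> n \<Longrightarrow> \<phi> i \<le> i"
  using parent_0 parent_less[of i] by (cases "i = 0") auto

lemma iterate_le: "i \<le> n \<Longrightarrow> (\<phi> ^^ k) i \<le> i"
  using parent_le by (induction k) (auto intro: order_trans)

lemma iterate_0: "(\<phi> ^^ k) 0 = 0"
  using parent_0 by (induction k) auto

lemma iterate_less:
  assumes "i \<in> {1..n}" "0 < k"
  shows "(\<phi> ^^ k) i < i"
proof -
  obtain r where "k = Suc r" using assms(2) by (cases k) auto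
  then have "(\<phi> ^^ k) i = (\<phi> ^^ r) (\<phi> i)" by (simp add: funpow_swap1)
  also have "\<dots> \<le> \<phi> i" using parent_less[OF assms(1)] assms(1) by (intro iterate_le) auto
  also have "\<dots> < i" using assms(1) by (rule parent_less)
  finally show ?thesis .
qed

text \<open>
  The ancestors of \<open>i\<close>, the root \<open>0\<close> included, are its parent and the ancestors of the parent.
  The root counts itself as an ancestor, so it has depth \<open>1\<close> like its children; this is why
  \<open>dp_root\<close> and \<open>dp_step\<close> treat the children of the root separately.
\<close>

lemma dp_insert: "dp \<phi> i = card (insert (\<phi> i) {(\<phi> ^^ k) (\<phi> i) | k. 1 \<le> k})"
proof -
  have "{(\<phi> ^^ k) i | k. 1 \<le> k} = (\<lambda>k. (\<phi> ^^ Suc k) i) ` UNIV"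
  proof (intro equalityI subsetI)
    fix j
    assume "j \<in> {(\<phi> ^^ k) i | k. 1 \<le> k}"
    then obtain k where "j = (\<phi> ^^ k) i" "1 \<le> k" by blast
    then show "j \<in> (\<lambda>k. (\<phi> ^^ Suc k) i) ` UNIV" by (intro image_eqI[of _ _ "k - 1"]) simp_all
  next
    fix j
    assume "j \<in> (\<lambda>k. (\<phi> ^^ Suc k) i) ` UNIV"
    then obtain k where "j = (\<phi> ^^ Suc k) i" by blast
    then show "j \<in> {(\<phi> ^^ k) i | k. 1 \<le> k}" by (intro CollectI exI[of _ "Suc k"]) simp
  qed
  also have "\<dots> = (\<lambda>k. (\<phi> ^^ k) (\<phi> i)) ` UNIV"
    by (simp add: funpow_Suc_right del: funpow.simps)
  also have "\<dots> = insert (\<phi> i) {(\<phi> ^^ k) (\<phi> i) | k. 1 \<le> k}"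
    by (auto simp: image_iff) (metis One_nat_def Suc_leI funpow_0 not_gr_zero, metis funpow_0)
  finally show ?thesis by (simp add: dp_def)
qed

lemma dp_root: "\<phi> i = 0 \<Longrightarrow> dp \<phi> i = 1"
  unfolding dp_insert by (simp add: iterate_0 card_insert_if)

lemma dp_step:
  assumes "i \<in> {1..n}" "\<phi> i \<noteq> 0"
  shows "dp \<phi> i = Suc (dp \<phi> (\<phi> i))"
proof -
  have i: "\<phi> i \<in> {1..n}" using assms parent_less[of i] by simp
  let ?S = "{(\<phi> ^^ k) (\<phi> i) | k. 1 \<le> k}"
  have "(\<phi> ^^ k) (\<phi> i) < \<phi> i" if "1 \<le> k" for k
    using iterate_less[OF i, of k] that by simp
  then have "?S \<subseteq> {..<\<phi> i}" by auto
  then have "finite ?S" "\<phi> i \<notin> ?S" by (auto intro: finite_subset)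
  then show ?thesis unfolding dp_insert[of i] by (simp add: dp_def)
qed

lemma dp_pos: "i \<in> {1..n} \<Longrightarrow> 1 \<le> dp \<phi> i"
  using dp_root[of i] dp_step[of i] by (cases "\<phi> i = 0") auto

lemma iterate_below_depth:
  assumes "i \<in> {1..n}" "r < dp \<phi> i"
  shows "(\<phi> ^^ r) i \<in> {1..n} \<and> dp \<phi> ((\<phi> ^^ r) i) = dp \<phi> i - r"
  using assms(2)
proof (induction r)
  case 0
  then show ?case using assms by simp
next
  case (Suc r)
  let ?j = "(\<phi> ^^ r) i"
  have j: "?j \<in> {1..n}" "dp \<phi> ?j = dp \<phi> i - r" using Suc by auto
  have "\<phi> ?j \<noteq> 0"
  proof
    assume "\<phi> ?j = 0"
    then have "dp \<phi> ?j = 1" by (rule dp_root)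
    then show False using j(2) Suc.prems by linarith
  qed
  then show ?case using dp_step[OF j(1)] j parent_less[OF j(1)] by auto
qed

lemma ancestor_in:
  assumes "i \<in> {1..n}" "1 \<le> l" "l \<le> dp \<phi> i"
  shows "ancestor \<phi> i l \<in> {1..n}" "dp \<phi> (ancestor \<phi> i l) = l"
  using iterate_below_depth[OF assms(1), of "dp \<phi> i - l"] assms by (auto simp: ancestor_def)

lemma ancestor_self: "ancestor \<phi> i (dp \<phi> i) = i"
  by (simp add: ancestor_def)

lemma ancestor_parent:
  assumes "Suc l \<le> dp \<phi> i"
  shows "ancestor \<phi> i l = \<phi> (ancestor \<phi> i (Suc l))"
proof -
  have "dp \<phi> i - l = Suc (dp \<phi> i - Suc l)" using assms by simp
  then show ?thesis by (simp add: ancestor_def)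
qed

lemma ancestor_ancestor:
  assumes "i \<in> {1..n}" "1 \<le> k" "k \<le> l" "l \<le> dp \<phi> i"
  shows "ancestor \<phi> (ancestor \<phi> i l) k = ancestor \<phi> i k"
proof -
  have "ancestor \<phi> (ancestor \<phi> i l) k = (\<phi> ^^ (l - k)) (ancestor \<phi> i l)"
    using ancestor_in(2)[OF assms(1), of l] assms by (simp add: ancestor_def[of _ _ k])
  also have "\<dots> = (\<phi> ^^ ((l - k) + (dp \<phi> i - l))) i" by (simp add: ancestor_def funpow_add)
  also have "(l - k) + (dp \<phi> i - l) = dp \<phi> i - k" using assms by simp
  finally show ?thesis by (simp add: ancestor_def)
qed

lemma ancestor_less:
  assumes "i \<in> {1..n}" "l < dp \<phi> i"
  shows "ancestor \<phi> i l < i"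
  using assms unfolding ancestor_def by (intro iterate_less) auto

lemma ancestor_mono:
  assumes "i \<in> {1..n}" "1 \<le> k" "k < l" "l \<le> dp \<phi> i"
  shows "ancestor \<phi> i k < ancestor \<phi> i l"
proof -
  have "1 \<le> l" using assms by simp
  note j = ancestor_in[OF assms(1) this assms(4)]
  have "ancestor \<phi> (ancestor \<phi> i l) k < ancestor \<phi> i l"
    using j assms by (intro ancestor_less) auto
  then show ?thesis using ancestor_ancestor[OF assms(1,2) _ assms(4)] assms(3) by simp
qed

text \<open>
  Nodes on a branch increase with depth, so listing the branch by depth is the same as selecting
  it from all earlier nodes in their order. This makes a context over a branch a filtered heap
  context, to which \<open>derived_weaken_filter\<close> applies.
\<close>

lemma branch_eq_filter:
  assumes "i \<in> {1..n}"
  shows "map (ancestor \<phi> i) [1..<dp \<phi> i] = filter (\<lambda>l. l \<in> ancestor \<phi> i ` {1..<dp \<phi> i}) [1..<i]"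
proof (rule sorted_distinct_set_unique)
  have mono: "strict_mono_on {1..<dp \<phi> i} (ancestor \<phi> i)"
    using ancestor_mono[OF assms] by (auto simp: strict_mono_on_def)
  then show "distinct (map (ancestor \<phi> i) [1..<dp \<phi> i])"
    using strict_mono_on_imp_inj_on by (auto simp: distinct_map)
  show "sorted (map (ancestor \<phi> i) [1..<dp \<phi> i])"
    using ancestor_mono[OF assms]
    by (auto simp: sorted_iff_nth_mono_less intro!: less_imp_le)
  show "set (map (ancestor \<phi> i) [1..<dp \<phi> i]) =
      set (filter (\<lambda>l. l \<in> ancestor \<phi> i ` {1..<dp \<phi> i}) [1..<i])"
    using ancestor_in(1)[OF assms] ancestor_less[OF assms] by fastforce
qed (auto intro: sorted_wrt_filter)

end

section \<open>Heap judgements are derivable\<close>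

lemma heap_args_conv: "heap_args x \<phi> i = map (Var \<circ> (x \<circ> ancestor \<phi> i)) [1..<dp \<phi> i]"
  by (simp add: heap_args_def ancestor_def)

lemma fv_heap_type: "fv (heap_type x \<phi> h i) = x ` ancestor \<phi> i ` {1..<dp \<phi> i}"
  by (auto simp: heap_type_def heap_args_conv)

lemma ctx_fv_map: "ctx_fv (map (\<lambda>i. (x i, f i)) is) = (\<Union>i \<in> set is. insert (x i) (fv (f i)))"
  by (auto simp: ctx_fv_def)

locale heap_map = heap n \<phi> for n \<phi> +
  fixes X :: "('a, 'b) psh" and h :: "(nat, unit, 'a, 'b) psh_map"
  assumes presheaf: "presheaf X" and hom: "h \<in> psh_hom (heap_psh n \<phi>) X"
begin

lemma value_in: "i \<in> {1..n} \<Longrightarrow> heap_value \<phi> h i \<in> ty X (dp \<phi> i)"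
  using hom by (auto simp: psh_hom_def heap_psh_def heap_value_def PiE_iff)

lemma value_parent:
  assumes "i \<in> {1..n}" "\<phi> i \<noteq> 0"
  shows "heap_value \<phi> h (\<phi> i) = bdty X (dp \<phi> (\<phi> i)) (heap_value \<phi> h i)"
proof -
  have "1 \<le> dp \<phi> (\<phi> i)" using assms parent_less[OF assms(1)] by (intro dp_pos) auto
  then show ?thesis
    using hom dp_step[OF assms] assms(1) by (auto simp: psh_hom_def heap_psh_def heap_value_def)
qed

text \<open>
  Naturality of \<open>h\<close> along a branch: the label of a node determines the labels of its ancestors
  as iterated boundaries, just as in the generic judgement of that label.
\<close>

lemma value_ancestor:
  assumes "i \<in> {1..n}" "1 \<le> l" "l \<le> dp \<phi> i"
  shows "heap_value \<phi> h (ancestor \<phi> i l) = bd_iter X (dp \<phi> i) (dp \<phi> i - l) (heap_value \<phi> h i)"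
  using assms(3,2)
proof (induction l rule: inc_induct)
  case base
  then show ?case by (simp add: ancestor_self)
next
  case (step l)
  let ?j = "ancestor \<phi> i (Suc l)"
  have j: "?j \<in> {1..n}" using ancestor_in(1)[OF assms(1)] step by simp
  have par: "\<phi> ?j = ancestor \<phi> i l" using ancestor_parent[of l i] step by simp
  have l: "ancestor \<phi> i l \<in> {1..n}" "dp \<phi> (ancestor \<phi> i l) = l"
    using ancestor_in[OF assms(1), of l] step by auto
  have "heap_value \<phi> h (ancestor \<phi> i l) = bdty X l (heap_value \<phi> h ?j)"
    using value_parent[OF j] l par by simp
  moreover have "dp \<phi> i - l = Suc (dp \<phi> i - Suc l)" "dp \<phi> i - Suc (dp \<phi> i - Suc l) = l"
    using step by auto
  ultimately show ?case using step by simp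
qed

text \<open>
  After renaming $x_l$ to the variable of the ancestor at depth \<open>l\<close>, the generic judgement of the
  label of \<open>i\<close> consists of the declarations of the heap context along the branch of \<open>i\<close>.
\<close>

lemma generic_on_branch:
  assumes "i \<in> {1..n}"
  shows "generic_type (x \<circ> ancestor \<phi> i) (dp \<phi> i) (heap_value \<phi> h i) = heap_type x \<phi> h i"
    and "generic_ctx (x \<circ> ancestor \<phi> i) X (dp \<phi> i) (heap_value \<phi> h i) =
      map (\<lambda>l. (x l, heap_type x \<phi> h l)) (map (ancestor \<phi> i) [1..<dp \<phi> i])"
proof -
  show "generic_type (x \<circ> ancestor \<phi> i) (dp \<phi> i) (heap_value \<phi> h i) = heap_type x \<phi> h i"
    by (simp add: generic_type_def heap_type_def heap_args_conv)
  have "generic_type (x \<circ> ancestor \<phi> i) l (bd_iter X (dp \<phi> i) (dp \<phi> i - l) (heap_value \<phi> h i)) =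
      heap_type x \<phi> h (ancestor \<phi> i l)" if "l \<in> {1..<dp \<phi> i}" for l
    using that ancestor_in[OF assms, of l] value_ancestor[OF assms, of l]
      ancestor_ancestor[OF assms, of _ l]
    by (simp add: generic_type_def heap_type_def heap_args_conv)
  then show "generic_ctx (x \<circ> ancestor \<phi> i) X (dp \<phi> i) (heap_value \<phi> h i) =
      map (\<lambda>l. (x l, heap_type x \<phi> h l)) (map (ancestor \<phi> i) [1..<dp \<phi> i])"
    by (simp add: generic_ctx_def)
qed

lemma weaken_from_branch:
  assumes "inj x" "i \<in> {1..n}"
    and types: "\<And>l. l \<in> {1..<i} \<Longrightarrow> (heap_ctx x l \<phi> h, IsTy (heap_type x \<phi> h l)) \<in> derived T"
    and J: "(map (\<lambda>l. (x l, heap_type x \<phi> h l)) (map (ancestor \<phi> i) [1..<dp \<phi> i]), J) \<in> derived T"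
  shows "(heap_ctx x i \<phi> h, J) \<in> derived T"
proof -
  define B where "B = ancestor \<phi> i ` {1..<dp \<phi> i}"
  let ?f = "\<lambda>l. (x l, heap_type x \<phi> h l)"
  let ?P = "\<lambda>d. fst d \<in> x ` B"
  have filt: "filter ?P (map ?f ls) = map ?f (filter (\<lambda>l. l \<in> B) ls)" for ls
    using assms(1) by (simp add: filter_map o_def inj_image_mem_iff)
  have "([] @ heap_ctx x i \<phi> h, J) \<in> derived T"
  proof (rule derived_weaken_filter[where P = ?P])
    show "([] @ filter ?P (heap_ctx x i \<phi> h), J) \<in> derived T"
      using J unfolding branch_eq_filter[OF assms(2)] B_def[symmetric]
      by (simp only: heap_ctx_def filt append_Nil)
  next
    fix \<Delta>\<^sub>1 y S \<Delta>\<^sub>2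
    assume "heap_ctx x i \<phi> h = \<Delta>\<^sub>1 @ (y, S) # \<Delta>\<^sub>2" and notin: "\<not> ?P (y, S)"
    then obtain us l vs where split: "[1..<i] = us @ l # vs" "\<Delta>\<^sub>1 = map ?f us"
        "y = x l" "S = heap_type x \<phi> h l" "\<Delta>\<^sub>2 = map ?f vs"
      by (auto simp: heap_ctx_def map_eq_append_conv map_eq_Cons_conv)
    have "1 + length us < i" using arg_cong[OF split(1), of length] by simp
    then have "1 + length us = l" using arg_cong[OF split(1), of "\<lambda>ls. ls ! length us"] by simp
    then have upt: "us = [1..<l]" "vs = [Suc l..<i]" "1 \<le> l" "l < i"
      using arg_cong[OF split(1), of "take (length us)"]
        arg_cong[OF split(1), of "drop (Suc (length us))"] \<open>1 + length us < i\<close>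
      by (auto simp: take_upt)
    have "l \<notin> B" using notin split(3) by auto
    have "(\<Delta>\<^sub>1, IsTy S) \<in> derived T"
      using types[of l] upt split by (simp add: heap_ctx_def)
    \<comment> \<open>Types to the left only mention nodes smaller than \<open>l\<close>.\<close>
    moreover have "y \<notin> ctx_fv \<Delta>\<^sub>1"
    proof -
      have "ancestor \<phi> m k \<noteq> l" if "m \<in> {1..<l}" "k \<in> {1..<dp \<phi> m}" for m k
        using ancestor_less[of m k] that upt assms(2) by auto
      then show ?thesis using assms(1) upt
        by (fastforce simp: split ctx_fv_map fv_heap_type dest: injD)
    qed
    \<comment> \<open>Types of branch nodes only mention branch nodes, and \<open>l\<close> is not one.\<close>
    moreover have "y \<notin> ctx_fv (filter ?P \<Delta>\<^sub>2)"
    proof -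
      have "ancestor \<phi> m k \<in> B" if m: "m \<in> B" and k: "k \<in> {1..<dp \<phi> m}" for m k
      proof -
        obtain r where r: "r \<in> {1..<dp \<phi> i}" "m = ancestor \<phi> i r" using m by (auto simp: B_def)
        then have "dp \<phi> m = r" using ancestor_in(2)[OF assms(2), of r] by simp
        then have "ancestor \<phi> m k = ancestor \<phi> i k" "k \<in> {1..<dp \<phi> i}"
          using ancestor_ancestor[OF assms(2), of k r] r k by auto
        then show ?thesis by (simp add: B_def)
      qed
      then show ?thesis using assms(1) upt \<open>l \<notin> B\<close>
        unfolding split(5) filt by (fastforce simp: split ctx_fv_map fv_heap_type dest: injD)
    qed
    ultimately show "([] @ \<Delta>\<^sub>1, IsTy S) \<in> derived T \<and>
        y \<notin> ctx_fv ([] @ \<Delta>\<^sub>1) \<union> ctx_fv (filter ?P \<Delta>\<^sub>2)" by simp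
  qed
  then show ?thesis by simp
qed

lemma branch_vars_inj: "inj x \<Longrightarrow> i \<in> {1..n} \<Longrightarrow> inj_on (x \<circ> ancestor \<phi> i) {1..<dp \<phi> i}"
  using ancestor_mono[of i]
  by (intro comp_inj_on strict_mono_on_imp_inj_on) (auto simp: strict_mono_on_def intro: inj_on_subset)

lemma heap_type_derived:
  assumes "inj x" "i \<in> {1..n}"
  shows "(heap_ctx x i \<phi> h, IsTy (heap_type x \<phi> h i)) \<in> derived (G x X)"
  using assms(2)
proof (induction i rule: less_induct)
  case (less i)
  show ?case
  proof (rule weaken_from_branch[OF assms(1) less.prems])
    show "(heap_ctx x l \<phi> h, IsTy (heap_type x \<phi> h l)) \<in> derived (G x X)" if "l \<in> {1..<i}" for l
      using less that by auto
    show "(map (\<lambda>l. (x l, heap_type x \<phi> h l)) (map (ancestor \<phi> i) [1..<dp \<phi> i]),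
        IsTy (heap_type x \<phi> h i)) \<in> derived (G x X)"
      using generic_derived_renamed(1)[OF presheaf assms(1) branch_vars_inj[OF assms(1) less.prems]
          value_in[OF less.prems]]
      by (simp only: J_type_def generic_on_branch[OF less.prems])
  qed
qed

lemma heap_term_derived:
  assumes "inj x" "i \<in> {1..n}" "a \<in> Tm X (dp \<phi> i) (heap_value \<phi> h i)"
  shows "(heap_ctx x i \<phi> h, HasTy (App (Inr (dp \<phi> i, a)) (heap_args x \<phi> i)) (heap_type x \<phi> h i))
    \<in> derived (G x X)"
proof (rule weaken_from_branch[OF assms(1,2)])
  show "(heap_ctx x l \<phi> h, IsTy (heap_type x \<phi> h l)) \<in> derived (G x X)" if "l \<in> {1..<i}" for l
    using heap_type_derived[OF assms(1)] that assms(2) by auto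
  have a: "a \<in> tm X (dp \<phi> i)" "bdtm X (dp \<phi> i) a = heap_value \<phi> h i"
    using assms(3) by (auto simp: Tm_def)
  show "(map (\<lambda>l. (x l, heap_type x \<phi> h l)) (map (ancestor \<phi> i) [1..<dp \<phi> i]),
      HasTy (App (Inr (dp \<phi> i, a)) (heap_args x \<phi> i)) (heap_type x \<phi> h i)) \<in> derived (G x X)"
    using generic_derived_renamed(2)[OF presheaf assms(1) branch_vars_inj[OF assms(1,2)] a(1)]
    by (simp only: J_term_def a(2) generic_on_branch[OF assms(2)] heap_args_conv)
qed

lemma heap_ty_equiv_refl:
  assumes "inj x" "i \<in> {1..n}"
  shows "ty_equiv (G x X) (heap_ctx x i \<phi> h, IsTy (heap_type x \<phi> h i))
    (heap_ctx x i \<phi> h, IsTy (heap_type x \<phi> h i))"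
proof -
  have "(take l (heap_ctx x i \<phi> h), EqTy S S) \<in> derived (G x X)"
    if l: "l \<le> length (heap_ctx x i \<phi> h)"
      and S: "S = telescope (heap_ctx x i \<phi> h) (heap_type x \<phi> h i) ! l" for l S
  proof -
    have "l < i" using l assms(2) by (auto simp: heap_ctx_def)
    then have "take l (heap_ctx x i \<phi> h) = heap_ctx x (Suc l) \<phi> h"
      by (simp add: heap_ctx_def take_map)
    moreover have "telescope (heap_ctx x i \<phi> h) (heap_type x \<phi> h i) = map (heap_type x \<phi> h) [1..<Suc i]"
      using assms(2) by (simp add: telescope_def heap_ctx_def o_def)
    then have "S = heap_type x \<phi> h (Suc l)"
      using \<open>l < i\<close> S by (simp del: upt_Suc)
    ultimately show ?thesis
      using heap_type_derived[OF assms(1), of "Suc l"] \<open>l < i\<close> assms(2)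
      by (auto simp: derived_def intro: deriv.ty_refl)
  qed
  then show ?thesis by (auto simp: ty_equiv_def subst_vars_same)
qed

lemma degree_heap: "1 \<le> i \<Longrightarrow> degree (heap_ctx x i \<phi> h, R) = i"
  by (simp add: degree_def heap_ctx_def)

lemma ty_rel_refl:
  assumes "inj x" "1 \<le> n"
  shows "(heap_ty_judgement x n (\<phi>, h), heap_ty_judgement x n (\<phi>, h)) \<in> ty_rel (G x X) n"
  using heap_type_derived[OF assms(1), of n] heap_ty_equiv_refl[OF assms(1), of n] assms(2)
  by (auto simp: heap_ty_judgement_def ty_rel_def derived_ty_def degree_heap)

lemma tm_rel_refl:
  assumes "inj x" "1 \<le> n" "a \<in> Tm X (dp \<phi> n) (heap_value \<phi> h n)"
  shows "(heap_tm_judgement x n ((\<phi>, h), a), heap_tm_judgement x n ((\<phi>, h), a)) \<in> tm_rel (G x X) n"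
  using heap_term_derived[OF assms(1) _ assms(3)] heap_ty_equiv_refl[OF assms(1), of n] assms(2)
  by (auto simp: heap_tm_judgement_def tm_rel_def derived_tm_def degree_heap tm_equiv_def
      subst_vars_same derived_def intro: deriv.tm_refl)

end

section \<open>The heap description is faithful\<close>

lemma heap_ctx_vars: "map fst (heap_ctx x n \<phi> h) = map x [1..<n]"
  by (simp add: heap_ctx_def)

text \<open>
  The last argument of the type at a node of depth at least \<open>2\<close> is the variable of its parent; a
  node of depth \<open>1\<close> has parent \<open>0\<close>.
\<close>

lemma heap_determined:
  assumes "inj x" "\<phi> \<in> Hp n" "\<psi> \<in> Hp n"
    and types: "\<And>i. i \<in> {1..n} \<Longrightarrow> heap_type x \<phi> h i = heap_type x \<psi> k i"
  shows "\<phi> = \<psi>"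
proof -
  interpret p: heap n \<phi> by unfold_locales (rule assms)
  interpret q: heap n \<psi> by unfold_locales (rule assms)
  have "\<phi> i = \<psi> i" if i: "i \<in> {1..n}" for i
  proof -
    have dp: "dp \<phi> i = dp \<psi> i" and args: "\<forall>l \<in> {1..<dp \<phi> i}. ancestor \<phi> i l = ancestor \<psi> i l"
      using types[OF i] assms(1) by (auto simp: heap_type_def heap_args_conv inj_eq)
    show ?thesis
    proof (cases "dp \<phi> i = 1")
      case True
      have "\<phi> i = 0" using p.dp_step[OF i] p.dp_pos[of "\<phi> i"] p.parent_less[OF i] i True
        by (cases "\<phi> i = 0") auto
      moreover have "\<psi> i = 0" using q.dp_step[OF i] q.dp_pos[of "\<psi> i"] q.parent_less[OF i] i True dp
        by (cases "\<psi> i = 0") auto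
      ultimately show ?thesis by simp
    next
      case False
      then obtain d where d: "dp \<phi> i = Suc d" "1 \<le> d" using p.dp_pos[OF i] by (cases "dp \<phi> i") auto
      then have "ancestor \<phi> i d = ancestor \<psi> i d"
        using args by simp
      then show ?thesis using d dp by (simp add: ancestor_def)
    qed
  qed
  then have "\<phi> i = \<psi> i" if "i \<in> {0..n}" for i
    using that p.parent_0 q.parent_0 by (cases "i = 0") auto
  then show ?thesis
    using assms(2,3) by (intro PiE_ext[of \<phi> "{0..n}" "\<lambda>_. {0..n}" \<psi>]) (auto simp: Hp_def)
qed

lemma heap_map_determined:
  assumes "h \<in> psh_hom (heap_psh n \<phi>) X" "k \<in> psh_hom (heap_psh n \<phi>) X"
    and vals: "\<And>i. i \<in> {1..n} \<Longrightarrow> heap_value \<phi> h i = heap_value \<phi> k i"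
  shows "h = k"
proof -
  have "on_ty h m = on_ty k m" for m
  proof (rule PiE_ext)
    show "on_ty h m \<in> ty (heap_psh n \<phi>) m \<rightarrow>\<^sub>E ty X m" "on_ty k m \<in> ty (heap_psh n \<phi>) m \<rightarrow>\<^sub>E ty X m"
      using assms(1,2) by (auto simp: psh_hom_def)
    show "on_ty h m i = on_ty k m i" if "i \<in> ty (heap_psh n \<phi>) m" for i
      using vals[of i] that by (auto simp: heap_psh_def heap_value_def)
  qed
  moreover have "on_tm h m = on_tm k m" for m
    using assms(1,2) by (intro PiE_ext[of _ "tm (heap_psh n \<phi>) m" "\<lambda>_. tm X m"])
      (auto simp: psh_hom_def, auto simp: heap_psh_def)
  ultimately show ?thesis by (intro psh_map.equality ext) simp_all
qed

lemma heap_judgements_determine_element: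
  assumes "inj x" "1 \<le> n" "(\<phi>, h) \<in> ty (W X) n" "(\<psi>, k) \<in> ty (W X) n"
    and equiv: "ty_equiv (G x X) (heap_ty_judgement x n (\<phi>, h)) (heap_ty_judgement x n (\<psi>, k))"
  shows "(\<phi>, h) = (\<psi>, k)"
proof -
  have ctx: "heap_ctx x n \<phi> h = heap_ctx x n \<psi> k" and last: "heap_type x \<phi> h n = heap_type x \<psi> k n"
    using ty_equiv_G_same_vars[OF equiv[unfolded heap_ty_judgement_def prod.case]]
    by (simp_all add: heap_ctx_vars)
  have types: "heap_type x \<phi> h i = heap_type x \<psi> k i" if "i \<in> {1..n}" for i
    using ctx last that by (cases "i = n") (auto simp: heap_ctx_def)
  have "\<phi> \<in> Hp n" "\<psi> \<in> Hp n" using assms(3,4) by (auto simp: W_def)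
  then have "\<phi> = \<psi>" using types by (rule heap_determined[OF assms(1)])
  moreover have "h = k"
  proof (rule heap_map_determined)
    show "h \<in> psh_hom (heap_psh n \<phi>) X" "k \<in> psh_hom (heap_psh n \<phi>) X"
      using assms(3,4) \<open>\<phi> = \<psi>\<close> by (auto simp: W_def)
    show "heap_value \<phi> h i = heap_value \<phi> k i" if "i \<in> {1..n}" for i
      using types[OF that] \<open>\<phi> = \<psi>\<close> by (simp add: heap_type_def)
  qed
  ultimately show ?thesis by simp
qed

text \<open>
  The second judgement is derivable and so lies in its own class. The classes being equal, it
  lies in that of the first judgement, which makes the two equivalent.
\<close>

lemma heap_ident_ty_inj:
  assumes "presheaf X" "inj x"
  shows "inj_on (on_ty (heap_ident x X) n) (ty (W X) n)"
proof (rule inj_onI)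
  fix v w
  assume v: "v \<in> ty (W X) n" and w: "w \<in> ty (W X) n"
    and eq: "on_ty (heap_ident x X) n v = on_ty (heap_ident x X) n w"
  obtain \<phi> h \<psi> k where vw: "v = (\<phi>, h)" "w = (\<psi>, k)" by (cases v, cases w)
  have n: "1 \<le> n" using v by (auto simp: W_def)
  have "heap_map n \<psi> X k" using w assms(1) vw by unfold_locales (auto simp: W_def)
  then have "heap_ty_judgement x n w \<in> ty_class (G x X) n (heap_ty_judgement x n w)"
    using heap_map.ty_rel_refl assms(2) n vw by auto
  then have "heap_ty_judgement x n w \<in> ty_class (G x X) n (heap_ty_judgement x n v)"
    using eq v w by (simp add: heap_ident_def)
  then have "ty_equiv (G x X) (heap_ty_judgement x n v) (heap_ty_judgement x n w)"
    by (simp add: ty_rel_def)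
  then show "v = w" using heap_judgements_determine_element[OF assms(2) n] v w vw by blast
qed

lemma heap_ident_tm_inj:
  assumes "presheaf X" "inj x"
  shows "inj_on (on_tm (heap_ident x X) n) (tm (W X) n)"
proof (rule inj_onI)
  fix v w
  assume v: "v \<in> tm (W X) n" and w: "w \<in> tm (W X) n"
    and eq: "on_tm (heap_ident x X) n v = on_tm (heap_ident x X) n w"
  obtain \<phi> h a \<psi> k b where vw: "v = ((\<phi>, h), a)" "w = ((\<psi>, k), b)" by (metis surj_pair)
  have n: "1 \<le> n" using v by (auto simp: W_def)
  have "heap_map n \<psi> X k" using w assms(1) vw by unfold_locales (auto simp: W_def)
  moreover have "b \<in> Tm X (dp \<psi> n) (heap_value \<psi> k n)" using w vw by (auto simp: W_def)
  ultimately have "heap_tm_judgement x n w \<in> tm_class (G x X) n (heap_tm_judgement x n w)"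
    using heap_map.tm_rel_refl assms(2) n vw by auto
  then have "heap_tm_judgement x n w \<in> tm_class (G x X) n (heap_tm_judgement x n v)"
    using eq v w by (simp add: heap_ident_def)
  then have equiv: "tm_equiv (G x X) (heap_tm_judgement x n v) (heap_tm_judgement x n w)"
    by (simp add: tm_rel_def)
  then have "ty_equiv (G x X) (heap_ty_judgement x n (\<phi>, h)) (heap_ty_judgement x n (\<psi>, k))"
    by (auto simp: tm_equiv_def heap_tm_judgement_def heap_ty_judgement_def vw)
  then have el: "(\<phi>, h) = (\<psi>, k)"
    using heap_judgements_determine_element[OF assms(2) n, of \<phi> h X \<psi> k] v w vw
    by (simp add: W_def)
  moreover have "a = b"
    using equiv el by (auto simp: tm_equiv_def heap_tm_judgement_def vw subst_vars_same
        dest!: derived_G_EqTm)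
  ultimately show "v = w" using vw by simp
qed

section \<open>Linear heaps and generic judgements\<close>

lemma linear_heap_Hp: "linear_heap n \<in> Hp n"
  by (auto simp: linear_heap_def Hp_def)

lemma linear_heap_iterate: "i \<le> n \<Longrightarrow> (linear_heap n ^^ k) i = i - k"
  by (induction k) (auto simp: linear_heap_def)

lemma dp_linear_heap:
  assumes "i \<in> {1..n}"
  shows "dp (linear_heap n) i = i"
proof -
  have "{(linear_heap n ^^ k) i | k. 1 \<le> k} = {..<i}"
  proof (intro equalityI subsetI)
    show "j \<in> {(linear_heap n ^^ k) i | k. 1 \<le> k}" if "j \<in> {..<i}" for j
      using that assms linear_heap_iterate[of i n "i - j"] by (auto intro!: exI[of _ "i - j"])
  qed (use assms in \<open>auto simp: linear_heap_iterate\<close>)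
  then show ?thesis by (simp add: dp_def)
qed

lemma heap_psh_linear: "ty (heap_psh n (linear_heap n)) m = {1..n} \<inter> {m}"
  by (auto simp: heap_psh_def dp_linear_heap)

lemma tilde_value: "i \<in> {1..n} \<Longrightarrow> on_ty (tilde X n A) i i = bd_iter X n (n - i) A"
  by (simp add: tilde_def psh_restrict_def heap_psh_linear)

lemma heap_value_tilde:
  "i \<in> {1..n} \<Longrightarrow> heap_value (linear_heap n) (tilde X n A) i = bd_iter X n (n - i) A"
  by (simp add: heap_value_def dp_linear_heap tilde_value)

lemma tilde_hom:
  assumes "presheaf X" "A \<in> ty X n"
  shows "tilde X n A \<in> psh_hom (heap_psh n (linear_heap n)) X"
proof -
  have "bd_iter X n (n - m) A \<in> ty X m" if "m \<in> {1..n}" for m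
    using bd_iter_mem[OF assms, of "n - m"] that by simp
  moreover have "bd_iter X n (n - m) A = bdty X m (bd_iter X n (n - Suc m) A)"
    if "Suc m \<le> n" for m
  proof -
    have "n - m = Suc (n - Suc m)" "n - Suc (n - Suc m) = m" using that by auto
    then show ?thesis by simp
  qed
  ultimately show ?thesis
    by (auto simp: psh_hom_def tilde_def psh_restrict_def heap_psh_linear)
      (auto simp: heap_psh_def linear_heap_def)
qed

lemma linear_element_in_W:
  assumes "presheaf X" "1 \<le> n" "A \<in> ty X n"
  shows "(linear_heap n, tilde X n A) \<in> ty (W X) n"
  using assms linear_heap_Hp tilde_hom by (auto simp: W_def)

lemma linear_term_in_W:
  assumes "presheaf X" "1 \<le> n" "A \<in> ty X n" "a \<in> Tm X n A"
  shows "((linear_heap n, tilde X n A), a) \<in> tm (W X) n"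
  using assms linear_heap_Hp tilde_hom heap_value_tilde[of n n X A]
  by (auto simp: W_def dp_linear_heap)

lemma heap_args_linear:
  assumes "i \<in> {1..n}"
  shows "heap_args x (linear_heap n) i = map (Var \<circ> x) [1..<i]"
  using assms by (auto simp: heap_args_def dp_linear_heap linear_heap_iterate)

lemma heap_type_linear:
  "i \<in> {1..n} \<Longrightarrow>
    heap_type x (linear_heap n) (tilde X n A) i = generic_type x i (bd_iter X n (n - i) A)"
  by (simp add: heap_type_def generic_type_def dp_linear_heap heap_value_tilde heap_args_linear)

lemma heap_ctx_linear: "heap_ctx x n (linear_heap n) (tilde X n A) = generic_ctx x X n A"
  by (simp add: heap_ctx_def generic_ctx_def heap_type_linear)

lemma heap_ty_judgement_linear:
  "1 \<le> n \<Longrightarrow> heap_ty_judgement x n (linear_heap n, tilde X n A) = J_type x X n A"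
  by (simp add: heap_ty_judgement_def J_type_def heap_ctx_linear heap_type_linear)

lemma heap_tm_judgement_linear:
  assumes "1 \<le> n" "a \<in> Tm X n A"
  shows "heap_tm_judgement x n ((linear_heap n, tilde X n A), a) = J_term x X n a"
  using assms by (simp add: heap_tm_judgement_def J_term_def heap_ctx_linear heap_type_linear
      heap_args_linear dp_linear_heap Tm_def)

text \<open>
  This gives naturality of the unit in the boundary of types: truncating the linear heap by its
  last node leaves the iterated boundaries of \<open>A\<close> below \<open>A\<close>, which are those of its boundary.
\<close>

lemma boundary_linear_element:
  assumes "1 \<le> n"
  shows "bdty (W X) n (linear_heap (Suc n), tilde X (Suc n) A) =
    (linear_heap n, tilde X n (bdty X n A))"
proof -
  have heap: "bd_heap n (linear_heap (Suc n)) = linear_heap n"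
    by (auto simp: bd_heap_def linear_heap_def)
  have "bd_iter X n (n - m) (bdty X n A) = bd_iter X (Suc n) (Suc n - m) A" if "m \<le> n" for m
    using that by (simp only: bd_iter_bd Suc_diff_le)
  then have "psh_restrict (heap_psh n (linear_heap n)) (tilde X (Suc n) A) = tilde X n (bdty X n A)"
    by (auto simp: tilde_def psh_restrict_def heap_psh_linear fun_eq_iff restrict_def)
      (auto simp: heap_psh_def)
  then show ?thesis by (simp add: W_def heap)
qed

section \<open>The unit\<close>

lemma unit_W_ty:
  assumes "presheaf X" "inj x" "1 \<le> n" "A \<in> ty X n"
  shows "on_ty (unit_W x X) n A = (linear_heap n, tilde X n A)"
proof -
  note el = linear_element_in_W[OF assms(1,3,4)]
  \<comment> \<open>Both sides are the class of one and the same judgement.\<close>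
  have "on_ty (adj_unit x X) n A = on_ty (heap_ident x X) n (linear_heap n, tilde X n A)"
    using el assms by (simp add: adj_unit_def heap_ident_def heap_ty_judgement_linear)
  then show ?thesis
    using the_inv_into_f_f[OF heap_ident_ty_inj[OF assms(1,2)] el] assms(4)
    by (simp add: unit_W_def)
qed

lemma unit_W_tm:
  assumes "presheaf X" "inj x" "1 \<le> n" "A \<in> ty X n" "a \<in> Tm X n A"
  shows "on_tm (unit_W x X) n a = ((linear_heap n, tilde X n A), a)"
proof -
  note el = linear_term_in_W[OF assms(1,3,4,5)]
  have a: "a \<in> tm X n" using assms(5) by (simp add: Tm_def)
  have "on_tm (adj_unit x X) n a = on_tm (heap_ident x X) n ((linear_heap n, tilde X n A), a)"
    using el a assms by (simp add: adj_unit_def heap_ident_def heap_tm_judgement_linear)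
  then show ?thesis
    using the_inv_into_f_f[OF heap_ident_tm_inj[OF assms(1,2)] el] a
    by (simp add: unit_W_def)
qed

theorem proposition20:
  fixes X :: "('a, 'b) psh" and x :: "nat \<Rightarrow> 'v::countable"
  assumes "presheaf X" and "inj x"
  shows "unit_W x X \<in> psh_hom X (W X) \<and>
    psh_comp X (heap_ident x X) (unit_W x X) = adj_unit x X \<and>
    (\<forall>n\<ge>1. \<forall>A \<in> ty X n.
       on_ty (unit_W x X) n A = (linear_heap n, tilde X n A) \<and>
       (\<forall>a \<in> Tm X n A.
          on_tm (unit_W x X) n a \<in> Tm (W X) n (linear_heap n, tilde X n A) \<and>
          on_tm (unit_W x X) n a = ((linear_heap n, tilde X n A), a)))"
proof -
  note unit_ty = unit_W_ty[OF assms] and unit_tm = unit_W_tm[OF assms]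
  have pos: "1 \<le> n" if "A \<in> ty X n \<or> a \<in> tm X n" for n A a
    using that assms(1) by (cases n) (auto simp: presheaf_def)
  have bd: "bdtm X n a \<in> ty X n" "a \<in> Tm X n (bdtm X n a)" if "a \<in> tm X n" for n a
    using psh_bdtm[OF assms(1) pos that] that by (auto simp: Tm_def)
  have ty_mem: "on_ty (unit_W x X) n A \<in> ty (W X) n" if "A \<in> ty X n" for n A
    using linear_element_in_W[OF assms(1)] unit_ty pos that by metis
  have tm_mem: "on_tm (unit_W x X) n a \<in> tm (W X) n" if "a \<in> tm X n" for n a
    using linear_term_in_W[OF assms(1)] unit_tm pos bd that by metis
  have hom: "unit_W x X \<in> psh_hom X (W X)"
    unfolding psh_hom_def
  proof (intro CollectI conjI allI impI ballI)
    show "on_ty (unit_W x X) n \<in> ty X n \<rightarrow>\<^sub>E ty (W X) n" for n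
      using ty_mem by (auto simp: PiE_iff) (simp add: unit_W_def)
    show "on_tm (unit_W x X) n \<in> tm X n \<rightarrow>\<^sub>E tm (W X) n" for n
      using tm_mem by (auto simp: PiE_iff) (simp add: unit_W_def)
    show "on_ty (unit_W x X) n (bdty X n A) = bdty (W X) n (on_ty (unit_W x X) (Suc n) A)"
      if "1 \<le> n" "A \<in> ty X (Suc n)" for n A
      using that psh_bd[OF assms(1) that] by (simp add: unit_ty boundary_linear_element)
    show "on_ty (unit_W x X) n (bdtm X n a) = bdtm (W X) n (on_tm (unit_W x X) n a)"
      if "1 \<le> n" "a \<in> tm X n" for n a
      using that bd[of a n] unit_tm[of n "bdtm X n a" a] by (simp add: unit_ty W_def)
  qed
  have comp: "psh_comp X (heap_ident x X) (unit_W x X) = adj_unit x X"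
  proof -
    have "on_ty (heap_ident x X) n (on_ty (unit_W x X) n A) = on_ty (adj_unit x X) n A"
      if "A \<in> ty X n" for n A
      using ty_mem[OF that] that pos[of A n]
      by (auto simp: unit_ty heap_ident_def adj_unit_def heap_ty_judgement_linear)
    moreover have "on_tm (heap_ident x X) n (on_tm (unit_W x X) n a) = on_tm (adj_unit x X) n a"
      if "a \<in> tm X n" for n a
      using tm_mem[OF that] that pos[of _ n a] bd[OF that] unit_tm[of n "bdtm X n a" a]
      by (auto simp: heap_ident_def adj_unit_def heap_tm_judgement_linear)
    ultimately show ?thesis
      by (auto simp: psh_comp_def compose_def fun_eq_iff restrict_def adj_unit_def)
  qed
  have "on_tm (unit_W x X) n a \<in> Tm (W X) n (linear_heap n, tilde X n A)"
    if "1 \<le> n" "A \<in> ty X n" "a \<in> Tm X n A" for n A a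
    using unit_tm[OF that] linear_term_in_W[OF assms(1) that] by (simp add: Tm_def W_def)
  with hom comp show ?thesis by (simp add: unit_ty unit_tm)
qed

end
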